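(* Let $\alpha$ be a non-zero algebraic number and write $\bar{\mathcal B}(\alpha)=\{\bar b_1,\ldots,\bar b_N\}$, indexed so that $\bar M(\bar b_1)\le \bar M(\bar b_2)\le\cdots\le \bar M(\bar b_N)$. If $J$ is the smallest index such that $\pi(\alpha)\in\operatorname{span}_{\mathbb Q}\{\bar b_1,\ldots,\bar b_J\}$ (span taken in the $\mathbb Q$-vector space $V$), then $M_\infty(\alpha)=\bar M(\bar b_J)$.
   Context: For a non-zero algebraic number $\gamma$ with minimal polynomial $A\prod_{n=1}^N(x-\gamma_n)$ over $\mathbb Z$ (primitive, $A>0$), its Mahler measure is $M(\gamma)=A\prod_{n=1}^N\max\{1,|\gamma_n|\}$. The ultrametric Mahler measure is $M_\infty(\alpha)=\inf\{\max_{1\le n\le N}M(\alpha_n): N\in\mathbb N,\ \alpha_n\in\overline{\mathbb Q}^\times,\ \alpha=\alpha_1\cdots\alpha_N\}$. Let $V=\overline{\mathbb Q}^\times/\mathrm{Tor}(\overline{\mathbb Q}^\times)$, a vector space over $\mathbb Q$ written multiplicatively, with scalar multiplication $\bar\beta\mapsto\bar\beta^r$ ($r\in\mathbb Q$) induced by taking any $r$-th power; let $\pi:\overline{\mathbb Q}^\times\to V$ be the quotient map. The modified Mahler measure is $\bar M(\beta)=\inf\{M(\zeta\beta):\zeta \text{ a root of unity}\}$; it is well-defined on $V$, and for $\bar\beta\in V$, $\bar M(\bar\beta)=\inf\{M(\beta):\beta\in\pi^{-1}(\bar\beta)\}$. Let $K_\alpha$ be the Galois closure of $\mathbb Q(\alpha)$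 over $\mathbb Q$, $\mathcal B(\alpha)=\{\gamma\in K_\alpha^\times: M(\gamma)\le M(\alpha)\}$ (a finite set), and $\bar{\mathcal B}(\alpha)=\pi(\mathcal B(\alpha))$. *)

theory Defs
  imports "Berlekamp_Zassenhaus.Mahler_Measure" "HOL-Library.Set_Algebras"
begin

definition alg_units :: "complex set" where
  "alg_units = {x. algebraic x \<and> x \<noteq> 0}"

text \<open>Minimal polynomial over the integers: the (unique) irreducible integer polynomial
  with positive leading coefficient vanishing at the number (irreducible in Z[x] forces it
  to be primitive and non-constant).\<close>
definition min_int_poly :: "complex \<Rightarrow> int poly" where
  "min_int_poly g = (THE p. irreducible p \<and> lead_coeff p > 0 \<and>
                          poly (map_poly of_int p) g = 0)"

definition M :: "complex \<Rightarrow> real" where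
  "M g = mahler_measure (min_int_poly g)"

definition M_inf :: "complex \<Rightarrow> real" where
  "M_inf a = Inf {Max (M ` set xs) | xs. xs \<noteq> [] \<and> set xs \<subseteq> alg_units \<and> a = prod_list xs}"

definition tor :: "complex set" where
  "tor = {z. \<exists>n>0. z ^ n = 1}"

text \<open>The quotient V = alg_units / tor; an element of V is represented by its coset
  (a set of complex numbers); piV is the quotient map.\<close>
definition piV :: "complex \<Rightarrow> complex set" where
  "piV b = (\<lambda>z. z * b) ` tor"

definition V :: "complex set set" where
  "V = piV ` alg_units"

text \<open>Q-scalar multiplication on V (written multiplicatively): the class of any r-th power.
  With r = p/q (q > 0, lowest terms), the class of y with y^q = x^p.\<close>
definition vpow :: "rat \<Rightarrow> complex set \<Rightarrow> complex set" where
  "vpow r c = {y. \<exists>x\<in>c. y \<noteq> 0 \<and>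
      y ^ nat (snd (quotient_of r)) = x powi fst (quotient_of r)}"

text \<open>Q-linear span in V: all finite Q-linear combinations (products of rational powers);
  the group operation on classes is pointwise multiplication of sets, and the
  zero vector of V is tor.\<close>
definition vspan :: "complex set set \<Rightarrow> complex set set" where
  "vspan S = {v. \<exists>t r. finite t \<and> t \<subseteq> S \<and> v = tor * (\<Prod>s\<in>t. vpow (r s) s)}"

definition Mbar :: "complex \<Rightarrow> real" where
  "Mbar b = Inf {M (z * b) | z. z \<in> tor}"

definition Mbar_V :: "complex set \<Rightarrow> real" where
  "Mbar_V c = Inf (M ` c)"

definition is_subfield_C :: "complex set \<Rightarrow> bool" where
  "is_subfield_C S \<longleftrightarrow> 0 \<in> S \<and> 1 \<in> S \<and>
     (\<forall>x\<in>S. \<forall>y\<in>S. x + y \<in> S \<and> x * y \<in> S) \<and> (\<forall>x\<in>S. - x \<in> S \<and> inverse x \<in> S)"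

definition conjugates :: "complex \<Rightarrow> complex set" where
  "conjugates a = {z. poly (map_poly of_int (min_int_poly a)) z = 0}"

definition K :: "complex \<Rightarrow> complex set" where
  "K a = \<Inter> {S. is_subfield_C S \<and> conjugates a \<subseteq> S}"

definition B :: "complex \<Rightarrow> complex set" where
  "B a = {g \<in> K a. g \<noteq> 0 \<and> M g \<le> M a}"

definition Bbar :: "complex \<Rightarrow> complex set set" where
  "Bbar a = piV ` B a"

end

theory Submission
  imports Defs "Jordan_Normal_Form.Char_Poly"
begin

text \<open>
  Upper bound: if \<open>w ^ n = x\<close> and \<open>f\<close> is the minimal polynomial of \<open>x\<close>, then \<open>w\<close> is a root of \<open>f(X^n)\<close>,
  which has the same Mahler measure as \<open>f\<close>; so roots, like inverses, do not increase \<open>M\<close>, and a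
  rational power of \<open>x\<close> is a root of unity times a product of numbers of measure at most \<open>M x\<close>.

  Lower bound: let \<open>\<alpha> = \<alpha>\<^sub>1 \<cdots> \<alpha>\<^sub>n\<close>, let \<open>H\<close> be the group of automorphisms of the algebraic numbers that
  fix \<open>K \<alpha>\<close>, and let \<open>\<beta>\<^sub>i\<close> be the product of the \<open>H\<close>-orbit of \<open>\<alpha>\<^sub>i\<close>. Multiplying over the \<open>H\<close>-orbit of the
  tuple of the \<open>\<alpha>\<^sub>i\<close> writes a power of \<open>\<alpha>\<close> as a product of powers of the \<open>\<beta>\<^sub>i\<close>, which lie in \<open>K \<alpha>\<close>.
  Moreover \<open>M \<beta>\<^sub>i \<le> M \<alpha>\<^sub>i\<close>: if \<open>A\<close> is the leading coefficient and \<open>Z\<close> the root set of the minimal polynomial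
  of \<open>\<alpha>\<^sub>i\<close>, then \<open>A\<close> times the product of \<open>X - \<Prod>W\<close> over the \<open>H\<close>-orbits \<open>W\<close> in \<open>Z\<close> is Galois-invariant,
  because \<open>K \<alpha>\<close> is normal, and its coefficients are algebraic integers, so it lies in \<open>\<int>[X]\<close>.
  Hence if all \<open>M \<alpha>\<^sub>i\<close> were below \<open>Mbar_V (b J)\<close>, the classes of the \<open>\<beta>\<^sub>i\<close> would be among the \<open>b j\<close> with \<open>j < J\<close>
  and would already span \<open>piV \<alpha>\<close>.
\<close>

section \<open>Polynomials over subrings and algebraic integers\<close>

text \<open>Weaker than \<open>is_subfield_C\<close>, so that polynomial arithmetic also covers the
  algebraic integers and rings finitely generated over the integers.\<close>

definition is_subring_C :: "complex set \<Rightarrow> bool" where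
  "is_subring_C S \<longleftrightarrow> 0 \<in> S \<and> 1 \<in> S \<and>
     (\<forall>x\<in>S. \<forall>y\<in>S. x + y \<in> S \<and> x * y \<in> S) \<and> (\<forall>x\<in>S. - x \<in> S)"

lemma is_subring_CD:
  assumes "is_subring_C S"
  shows "0 \<in> S" "1 \<in> S" "x \<in> S \<Longrightarrow> y \<in> S \<Longrightarrow> x + y \<in> S" "x \<in> S \<Longrightarrow> y \<in> S \<Longrightarrow> x * y \<in> S"
    "x \<in> S \<Longrightarrow> - x \<in> S" "x \<in> S \<Longrightarrow> y \<in> S \<Longrightarrow> x - y \<in> S"
  using assms unfolding is_subring_C_def
  by (blast, blast, blast, blast, blast, metis add_uminus_conv_diff)

lemma is_subring_C_sum:
  assumes "is_subring_C S" "\<And>a. a \<in> A \<Longrightarrow> f a \<in> S"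
  shows "sum f A \<in> S"
  using assms(2) by (induction A rule: infinite_finite_induct) (auto intro: is_subring_CD[OF assms(1)])

lemma is_subring_C_prod:
  assumes "is_subring_C S" "\<And>a. a \<in> A \<Longrightarrow> f a \<in> S"
  shows "prod f A \<in> S"
  using assms(2) by (induction A rule: infinite_finite_induct) (auto intro: is_subring_CD[OF assms(1)])

lemma is_subring_C_power: "is_subring_C S \<Longrightarrow> x \<in> S \<Longrightarrow> x ^ n \<in> S"
  by (induction n) (auto intro: is_subring_CD)

lemma is_subring_C_of_int: "is_subring_C S \<Longrightarrow> of_int k \<in> S"
proof (induction k rule: int_induct[of _ 0])
  case base then show ?case by (simp add: is_subring_CD)
next
  case (step1 i) then show ?case by (simp add: is_subring_CD)
next
  case (step2 i) then show ?case by (simp add: is_subring_CD)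
qed

definition polys_over :: "complex set \<Rightarrow> complex poly set" where
  "polys_over S = {p. \<forall>i. coeff p i \<in> S}"

lemma polys_over_coeff: "p \<in> polys_over S \<Longrightarrow> coeff p i \<in> S"
  by (simp add: polys_over_def)

lemma polys_over_closed:
  assumes "is_subring_C S"
  shows "0 \<in> polys_over S" "1 \<in> polys_over S"
    "p \<in> polys_over S \<Longrightarrow> q \<in> polys_over S \<Longrightarrow> p + q \<in> polys_over S"
    "p \<in> polys_over S \<Longrightarrow> q \<in> polys_over S \<Longrightarrow> p - q \<in> polys_over S"
    "p \<in> polys_over S \<Longrightarrow> q \<in> polys_over S \<Longrightarrow> p * q \<in> polys_over S"
    "p \<in> polys_over S \<Longrightarrow> - p \<in> polys_over S"
    "c \<in> S \<Longrightarrow> p \<in> polys_over S \<Longrightarrow> smult c p \<in> polys_over S"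
    "c \<in> S \<Longrightarrow> p \<in> polys_over S \<Longrightarrow> pCons c p \<in> polys_over S"
    "c \<in> S \<Longrightarrow> monom c n \<in> polys_over S"
    "p \<in> polys_over S \<Longrightarrow> pderiv p \<in> polys_over S"
  using is_subring_CD[OF assms] is_subring_C_of_int[OF assms, of "int _"]
  by (auto simp: polys_over_def coeff_mult coeff_pCons coeff_pderiv
      simp del: of_nat_Suc intro!: is_subring_C_sum[OF assms] split: nat.splits)

lemma polys_over_poly:
  assumes "is_subring_C S" "p \<in> polys_over S" "x \<in> S"
  shows "poly p x \<in> S"
  unfolding poly_altdef using assms
  by (auto intro!: is_subring_C_sum is_subring_CD(4) is_subring_C_power polys_over_coeff)

text \<open>Division by a monic polynomial needs no inverses, so quotient and remainder stay over
  the subring. The remainder is bounded by vanishing coefficients instead of degrees; for constant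
  \<open>m\<close> the bound thus says \<open>r = 0\<close>.\<close>

lemma polys_over_divide_monic:
  assumes S: "is_subring_C S" and p: "p \<in> polys_over S" and m: "m \<in> polys_over S" "lead_coeff m = 1"
  obtains s r where "s \<in> polys_over S" "r \<in> polys_over S" "p = m * s + r"
    "\<And>i. i \<ge> degree m \<Longrightarrow> coeff r i = 0"
proof -
  \<comment> \<open>Induction on the number \<open>n\<close> of coefficients still to be cleared;
    the value \<open>Suc (degree p)\<close> used at the end always suffices, also for
    \<open>p = 0\<close>.\<close>
  have "\<exists>s\<in>polys_over S. \<exists>r\<in>polys_over S. p = m * s + r \<and> (\<forall>i\<ge>degree m. coeff r i = 0)"
    if "\<forall>i\<ge>n + degree m. coeff p i = 0" for n
    using that p
  proof (induction n arbitrary: p)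
    case 0
    then show ?case using polys_over_closed(1)[OF S]
      by (intro bexI[of _ 0] bexI[of _ p]) auto
  next
    case (Suc n)
    define c where "c = coeff p (n + degree m)"
    define q where "q = p - monom c n * m"
    have c: "c \<in> S" using Suc.prems by (simp add: c_def polys_over_coeff)
    have "q \<in> polys_over S" unfolding q_def using Suc.prems c m
      by (intro polys_over_closed[OF S]) auto
    moreover have "\<forall>i\<ge>n + degree m. coeff q i = 0"
    proof (intro allI impI)
      fix i assume i: "i \<ge> n + degree m"
      show "coeff q i = 0"
      proof (cases "i = n + degree m")
        case True
        then show ?thesis using m(2) by (simp add: q_def c_def coeff_monom_mult)
      next
        case False
        then have "coeff m (i - n) = 0" using i by (intro coeff_eq_0) linarith
        then show ?thesis using Suc.prems(1) i False by (simp add: q_def coeff_monom_mult)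
      qed
    qed
    ultimately obtain s r where sr: "s \<in> polys_over S" "r \<in> polys_over S" "q = m * s + r"
      "\<forall>i\<ge>degree m. coeff r i = 0" using Suc.IH[of q] by blast
    have "p = m * (s + monom c n) + r" using sr(3) by (simp add: q_def algebra_simps)
    then show ?case using sr c
      by (intro bexI[of _ "s + monom c n"] bexI[of _ r]) (auto intro: polys_over_closed[OF S])
  qed
  from this[of "Suc (degree p)"] show thesis using that
    by (force intro: coeff_eq_0)
qed

section \<open>Integrality through rings that are finitely generated as additive groups\<close>

definition Zspan :: "complex set \<Rightarrow> complex set" where
  "Zspan S = {\<Sum>s\<in>S. of_int (c s) * s | c. True}"

lemma Zspan_add: "x \<in> Zspan S \<Longrightarrow> y \<in> Zspan S \<Longrightarrow> x + y \<in> Zspan S"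
proof -
  assume "x \<in> Zspan S" "y \<in> Zspan S"
  then obtain c d where "x = (\<Sum>s\<in>S. of_int (c s) * s)" "y = (\<Sum>s\<in>S. of_int (d s) * s)"
    unfolding Zspan_def by blast
  then have "x + y = (\<Sum>s\<in>S. of_int (c s + d s) * s)"
    by (simp add: sum.distrib algebra_simps)
  then show ?thesis unfolding Zspan_def by (intro CollectI exI[of _ "\<lambda>s. c s + d s"]) simp
qed

lemma Zspan_sum:
  assumes "\<And>a. a \<in> A \<Longrightarrow> f a \<in> Zspan S"
  shows "sum f A \<in> Zspan S"
proof -
  have "0 \<in> Zspan S" unfolding Zspan_def by (auto intro!: exI[of _ "\<lambda>_. 0"])
  then show ?thesis using assms
    by (induction A rule: infinite_finite_induct) (auto intro: Zspan_add)
qed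

lemma Zspan_base: "finite S \<Longrightarrow> s \<in> S \<Longrightarrow> of_int k * s \<in> Zspan S"
  unfolding Zspan_def by (intro CollectI exI[of _ "\<lambda>t. if t = s then k else 0"]) (simp add: if_distrib if_distribR cong: if_cong)

text \<open>Finitely generated as an additive group, not merely as a ring; this is what forces
  integrality.\<close>

definition fin_gen_ring :: "complex set \<Rightarrow> bool" where
  "fin_gen_ring R \<longleftrightarrow> is_subring_C R \<and> (\<exists>S. finite S \<and> S \<subseteq> R \<and> R \<subseteq> Zspan S)"

text \<open>Determinant trick: multiplication by \<open>x\<close> maps each generator to an integer
  combination of generators. The vector of generators is then an eigenvector of an integer matrix
  for the eigenvalue \<open>x\<close>, and the characteristic polynomial is monic with integer
  coefficients.\<close>

lemma fin_gen_ring_algebraic_int: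
  assumes "fin_gen_ring R" "x \<in> R"
  shows "algebraic_int x"
proof -
  from assms(1) obtain S where R: "is_subring_C R" and S: "finite S" "S \<subseteq> R" "R \<subseteq> Zspan S"
    unfolding fin_gen_ring_def by blast
  define n where "n = card S"
  obtain w where w: "bij_betw w {0..<n} S"
    using ex_bij_betw_nat_finite[OF S(1)] n_def by blast
  have "\<forall>i\<in>{0..<n}. \<exists>c. x * w i = (\<Sum>s\<in>S. of_int (c s) * s)"
  proof
    fix i assume "i \<in> {0..<n}"
    then have "w i \<in> R" using w S(2) by (auto simp: bij_betw_def)
    then have "x * w i \<in> Zspan S" using S(3) assms(2) is_subring_CD(4)[OF R] by blast
    then show "\<exists>c. x * w i = (\<Sum>s\<in>S. of_int (c s) * s)" unfolding Zspan_def by blast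
  qed
  then obtain c where c: "\<And>i. i \<in> {0..<n} \<Longrightarrow> x * w i = (\<Sum>s\<in>S. of_int (c i s) * s)"
    by metis
  define A where "A = mat n n (\<lambda>(i,j). c i (w j))"
  define A' :: "complex mat" where "A' = map_mat of_int A"
  define v where "v = vec n w"
  have A: "A \<in> carrier_mat n n" and A': "A' \<in> carrier_mat n n" by (auto simp: A_def A'_def)
  have "A' *\<^sub>v v = x \<cdot>\<^sub>v v"
  proof (rule eq_vecI)
    fix i assume "i < dim_vec (x \<cdot>\<^sub>v v)"
    then have i: "i < n" by (simp add: v_def)
    have "(A' *\<^sub>v v) $ i = (\<Sum>j = 0..<n. of_int (c i (w j)) * w j)"
      using i by (simp add: A'_def A_def v_def scalar_prod_def)
    also have "\<dots> = (\<Sum>s\<in>S. of_int (c i s) * s)"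
      by (rule sum.reindex_bij_betw[OF w])
    also have "\<dots> = x * w i" using c i by simp
    finally show "(A' *\<^sub>v v) $ i = (x \<cdot>\<^sub>v v) $ i" using i by (simp add: v_def)
  qed (simp add: A'_def A_def v_def)
  \<comment> \<open>The generators cannot all vanish, because 1 lies in their span.\<close>
  moreover have "v \<noteq> 0\<^sub>v n"
  proof
    assume v0: "v = 0\<^sub>v n"
    have "s = 0" if s: "s \<in> S" for s
    proof -
      obtain i where "i < n" "s = w i" using s bij_betw_imp_surj_on[OF w] by force
      then show ?thesis using arg_cong[OF v0, of "\<lambda>u. u $ i"] by (simp add: v_def)
    qed
    then have "Zspan S \<subseteq> {0}" by (auto simp: Zspan_def intro!: sum.neutral)
    then show False using S(3) is_subring_CD(2)[OF R] by auto
  qed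
  ultimately have "eigenvalue A' x" using A'
    unfolding eigenvalue_def eigenvector_def by (intro exI[of _ v]) (auto simp: v_def)
  then have "poly (char_poly A') x = 0" using eigenvalue_root_char_poly[OF A'] by simp
  moreover have "char_poly A' = map_poly of_int (char_poly A)"
    unfolding A'_def using of_int_hom.char_poly_hom[OF A] by simp
  ultimately show ?thesis using degree_monic_char_poly[OF A]
    unfolding algebraic_int_altdef_ipoly by auto
qed

text \<open>\<open>R'\<close> is the ring \<open>R[y]\<close>: division by the monic polynomial
  \<open>m\<close> reduces powers of \<open>y\<close> to exponents below \<open>n\<close>, so the
  products \<open>s * y ^ j\<close> with \<open>j < n\<close> generate it additively.\<close>

lemma fin_gen_ring_adjoin:
  assumes "fin_gen_ring R" and c: "\<And>i. i < n \<Longrightarrow> c i \<in> R" and y: "y ^ n = (\<Sum>i<n. c i * y ^ i)"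
  obtains R' where "fin_gen_ring R'" "R \<subseteq> R'" "y \<in> R'"
proof -
  from assms(1) obtain S where R: "is_subring_C R" and S: "finite S" "S \<subseteq> R" "R \<subseteq> Zspan S"
    unfolding fin_gen_ring_def by blast
  define R' where "R' = (\<lambda>p. poly p y) ` polys_over R"
  define T where "T = (\<lambda>(s, j). s * y ^ j) ` (S \<times> {..<n})"
  define m where "m = monom 1 n - (\<Sum>i<n. monom (c i) i)"
  have coeff_m: "coeff m i = (if i = n then 1 else if i < n then - c i else 0)" for i
    unfolding m_def by (auto simp: coeff_sum)
  have deg_m: "degree m = n"
    by (rule antisym[OF degree_le le_degree]) (auto simp: coeff_m)
  have m: "m \<in> polys_over R" "lead_coeff m = 1"
    using c is_subring_CD[OF R] by (auto simp: polys_over_def coeff_m deg_m)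
  have my: "poly m y = 0" using y by (simp add: m_def poly_sum poly_monom)
  have ring: "is_subring_C R'"
    unfolding is_subring_C_def
  proof (intro conjI ballI)
    show "0 \<in> R'" unfolding R'_def using polys_over_closed(1)[OF R] by (force intro: image_eqI[of _ _ 0])
    show "1 \<in> R'" unfolding R'_def using polys_over_closed(2)[OF R] by (force intro: image_eqI[of _ _ 1])
  next
    fix a b assume "a \<in> R'" "b \<in> R'"
    then obtain p q where pq: "p \<in> polys_over R" "q \<in> polys_over R" "a = poly p y" "b = poly q y"
      unfolding R'_def by blast
    show "a + b \<in> R'" unfolding R'_def using pq polys_over_closed(3)[OF R] by (force intro: image_eqI[of _ _ "p + q"])
    show "a * b \<in> R'" unfolding R'_def using pq polys_over_closed(5)[OF R] by (force intro: image_eqI[of _ _ "p * q"])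
  next
    fix a assume "a \<in> R'"
    then obtain p where "p \<in> polys_over R" "a = poly p y" unfolding R'_def by blast
    then show "- a \<in> R'" unfolding R'_def using polys_over_closed(6)[OF R] by (force intro: image_eqI[of _ _ "- p"])
  qed
  have sub: "R \<subseteq> R'"
  proof
    fix x assume "x \<in> R"
    then have "[:x:] \<in> polys_over R" using polys_over_closed[OF R] by auto
    then show "x \<in> R'" unfolding R'_def by (force intro: image_eqI[of _ _ "[:x:]"])
  qed
  have "[:0, 1:] \<in> polys_over R" using polys_over_closed[OF R] is_subring_CD[OF R] by auto
  then have y': "y \<in> R'" unfolding R'_def by (force intro: image_eqI[of _ _ "[:0, 1:]"])
  have T: "finite T" "T \<subseteq> R'"
    using S sub y' by (auto simp: T_def intro!: is_subring_CD(4)[OF ring] is_subring_C_power[OF ring])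
  have "R' \<subseteq> Zspan T"
  proof
    fix x assume "x \<in> R'"
    then obtain p where p: "p \<in> polys_over R" "x = poly p y" unfolding R'_def by blast
    obtain s r where sr: "s \<in> polys_over R" "r \<in> polys_over R" "p = m * s + r"
      "\<And>i. i \<ge> degree m \<Longrightarrow> coeff r i = 0" using polys_over_divide_monic[OF R p(1) m] by blast
    have r: "r = (\<Sum>i<n. monom (coeff r i) i)"
      using sr(4) deg_m by (intro poly_eqI) (auto simp: coeff_sum)
    have "x = poly r y" using p sr my by simp
    also have "\<dots> = (\<Sum>i<n. coeff r i * y ^ i)"
      by (subst r) (simp add: poly_sum poly_monom)
    also have "\<dots> \<in> Zspan T"
    proof (rule Zspan_sum)
      fix i assume i: "i \<in> {..<n}"
      have "coeff r i \<in> Zspan S" using sr(2) S(3) polys_over_coeff by blast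
      then obtain d where "coeff r i = (\<Sum>s\<in>S. of_int (d s) * s)" unfolding Zspan_def by blast
      then have "coeff r i * y ^ i = (\<Sum>s\<in>S. of_int (d s) * (s * y ^ i))"
        by (simp add: sum_distrib_right mult.assoc)
      also have "\<dots> \<in> Zspan T"
      proof (rule Zspan_sum)
        fix s assume "s \<in> S"
        then have "s * y ^ i \<in> T" using i unfolding T_def by force
        then show "of_int (d s) * (s * y ^ i) \<in> Zspan T" by (rule Zspan_base[OF T(1)])
      qed
      finally show "coeff r i * y ^ i \<in> Zspan T" .
    qed
    finally show "x \<in> Zspan T" .
  qed
  then have "fin_gen_ring R'" using ring T unfolding fin_gen_ring_def by blast
  then show thesis using sub y' that by blast
qed

lemma fin_gen_ring_Ints: "fin_gen_ring \<int>"
proof -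
  have "x \<in> Zspan {1}" if "x \<in> \<int>" for x
    using that unfolding Zspan_def by (elim Ints_cases) (auto intro!: exI)
  then show ?thesis unfolding fin_gen_ring_def is_subring_C_def
    by (intro conjI exI[of _ "{1}"]) auto
qed

lemma monic_poly_root_power:
  fixes x :: "'a :: comm_ring_1"
  assumes "lead_coeff p = 1" "poly p x = 0"
  shows "x ^ degree p = (\<Sum>i<degree p. - coeff p i * x ^ i)"
proof -
  have "0 = (\<Sum>i\<le>degree p. coeff p i * x ^ i)" using assms(2) by (simp add: poly_altdef)
  also have "\<dots> = (\<Sum>i<degree p. coeff p i * x ^ i) + x ^ degree p"
    using assms(1) by (simp add: lessThan_Suc_atMost[symmetric])
  finally have "x ^ degree p = - (\<Sum>i<degree p. coeff p i * x ^ i)" by (metis add.commute neg_eq_iff_add_eq_0)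
  then show ?thesis by (simp add: sum_negf)
qed

text \<open>The elements of \<open>X\<close> are adjoined one at a time, starting from the
  integers.\<close>

lemma algebraic_ints_in_fin_gen_ring:
  assumes "finite X" "\<And>x. x \<in> X \<Longrightarrow> algebraic_int x"
  shows "\<exists>R. fin_gen_ring R \<and> X \<subseteq> R"
  using assms
proof (induction X)
  case empty
  then show ?case using fin_gen_ring_Ints by blast
next
  case (insert x X)
  then obtain R where R: "fin_gen_ring R" "X \<subseteq> R" by auto
  obtain p where p: "poly (map_poly of_int p) x = 0" "lead_coeff p = 1"
    using insert.prems[of x] unfolding algebraic_int_altdef_ipoly by auto
  have "x ^ degree p = (\<Sum>i<degree p. - of_int (coeff p i) * x ^ i)"
    using monic_poly_root_power[of "map_poly of_int p" x] p by simp
  then obtain R' where "fin_gen_ring R'" "R \<subseteq> R'" "x \<in> R'"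
    using fin_gen_ring_adjoin[OF R(1), of "degree p" "\<lambda>i. - of_int (coeff p i)" x]
      is_subring_C_of_int R(1) is_subring_CD(5) unfolding fin_gen_ring_def by metis
  then show ?case using R by blast
qed

text \<open>Two algebraic integers lie in a common finitely generated ring, all of whose elements
  are algebraic integers.\<close>

lemma is_subring_C_algebraic_int: "is_subring_C {x. algebraic_int x}"
proof -
  have "algebraic_int (x + y) \<and> algebraic_int (x * y)" if xy: "algebraic_int x" "algebraic_int y" for x y :: complex
  proof -
    obtain R where R: "fin_gen_ring R" "x \<in> R" "y \<in> R"
      using algebraic_ints_in_fin_gen_ring[of "{x, y}"] xy by blast
    then have "x + y \<in> R" "x * y \<in> R" by (auto simp: fin_gen_ring_def is_subring_CD)
    then show ?thesis using fin_gen_ring_algebraic_int[OF R(1)] by blast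
  qed
  then show ?thesis by (auto simp: is_subring_C_def)
qed

text \<open>Transitivity of integrality: one finitely generated ring contains all coefficients, and
  adjoining \<open>x\<close> keeps it finitely generated.\<close>

lemma algebraic_int_integral:
  assumes "\<And>i. i < n \<Longrightarrow> algebraic_int (c i)" and "x ^ n = (\<Sum>i<n. c i * x ^ i)"
  shows "algebraic_int (x :: complex)"
proof -
  obtain R where R: "fin_gen_ring R" "c ` {..<n} \<subseteq> R"
    using algebraic_ints_in_fin_gen_ring[of "c ` {..<n}"] assms(1) by auto
  then obtain R' where "fin_gen_ring R'" "x \<in> R'"
    using fin_gen_ring_adjoin[of R n c x] assms(2) by blast
  then show ?thesis by (rule fin_gen_ring_algebraic_int)
qed

text \<open>With \<open>degree p = Suc n\<close>, multiplying the equation for \<open>x\<close> by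
  the power \<open>a ^ n\<close> of the leading coefficient \<open>a\<close> turns it into a monic
  equation for \<open>a * x\<close> whose coefficients are again algebraic integers.\<close>

lemma algebraic_int_lead_coeff_times_root:
  assumes p: "p \<in> polys_over {x. algebraic_int x}" and "poly p x = 0"
  shows "algebraic_int (lead_coeff p * x)"
proof (cases "degree p")
  case 0
  then have "p = 0" using assms(2) by (auto elim!: degree_eq_zeroE)
  then show ?thesis by simp
next
  case (Suc n)
  define a where "a = lead_coeff p"
  note ai = is_subring_C_algebraic_int
  have "0 = (\<Sum>i\<le>Suc n. coeff p i * x ^ i)" using assms(2) Suc by (simp add: poly_altdef)
  also have "\<dots> = (\<Sum>i<Suc n. coeff p i * x ^ i) + a * x ^ Suc n"
    using Suc by (simp add: a_def lessThan_Suc_atMost[symmetric])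
  finally have ax: "a * x ^ Suc n = (\<Sum>i<Suc n. - coeff p i * x ^ i)"
    by (metis (no_types, lifting) add.commute mult_minus_left neg_eq_iff_add_eq_0 sum.cong sum_negf)
  have "(a * x) ^ Suc n = a ^ n * (a * x ^ Suc n)" by (simp add: power_mult_distrib)
  also have "\<dots> = (\<Sum>i<Suc n. a ^ n * (- coeff p i * x ^ i))"
    unfolding ax by (simp only: sum_distrib_left)
  also have "\<dots> = (\<Sum>i<Suc n. (- coeff p i * a ^ (n - i)) * (a * x) ^ i)"
  proof (rule sum.cong)
    fix i assume "i \<in> {..<Suc n}"
    then have "a ^ n = a ^ (n - i) * a ^ i" by (simp add: power_add[symmetric])
    then show "a ^ n * (- coeff p i * x ^ i) = (- coeff p i * a ^ (n - i)) * (a * x) ^ i"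
      by (simp add: power_mult_distrib)
  qed simp
  finally show ?thesis unfolding a_def[symmetric]
  proof (rule algebraic_int_integral[rotated])
    fix i
    have "coeff p i \<in> {x. algebraic_int x}" "a \<in> {x. algebraic_int x}" using p
      unfolding a_def by (simp_all only: polys_over_coeff)
    then have "- coeff p i * a ^ (n - i) \<in> {x. algebraic_int x}"
      by (rule is_subring_CD(4)[OF ai is_subring_CD(5)[OF ai] is_subring_C_power[OF ai]])
    then show "algebraic_int (- coeff p i * a ^ (n - i))" by simp
  qed
qed

text \<open>A form of Gauss' lemma, proved by removing leading terms of \<open>h\<close>. If
  \<open>a\<close> is the leading coefficient, \<open>a * x\<close> is an algebraic integer since
  \<open>x\<close> is a root of the product, so subtracting \<open>monom a n\<close> from
  \<open>h\<close> keeps the coefficients of the product integral.\<close>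

lemma polys_over_algebraic_int_divide_linear:
  assumes "[:- x, 1:] * h \<in> polys_over {x. algebraic_int x}"
  shows "h \<in> polys_over {x. algebraic_int x}"
  using assms
proof (induction "degree h" arbitrary: h rule: less_induct)
  case less
  note ai = is_subring_C_algebraic_int
  let ?Z = "{x::complex. algebraic_int x}"
  show ?case
  proof (cases "h = 0")
    case False
    define a n where "a = lead_coeff h" and "n = degree h"
    define h' where "h' = h - monom a n"
    have lc: "lead_coeff ([:- x, 1:] * h) = a" by (simp only: lead_coeff_mult a_def) simp
    have "algebraic_int (a * x)"
      using algebraic_int_lead_coeff_times_root[OF less.prems, of x] unfolding lc by simp
    then have ax: "a * x \<in> ?Z" by simp
    have a: "a \<in> ?Z" using polys_over_coeff[OF less.prems] lc by metis
    have "[:- x, 1:] * h' = [:- x, 1:] * h - monom a (Suc n) + monom (a * x) n"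
      by (simp add: h'_def algebra_simps monom_Suc smult_monom add_monom)
    then have prem: "[:- x, 1:] * h' \<in> polys_over ?Z"
      using less.prems a ax by (auto intro: polys_over_closed[OF ai] simp del: mult_pCons_left)
    \<comment> \<open>A constant \<open>h\<close> equals its leading term, so the degree cannot drop
      and this case is settled without the induction hypothesis.\<close>
    have "h' \<in> polys_over ?Z"
    proof (cases "n = 0")
      case True
      then have "h' = 0" unfolding h'_def a_def n_def by (auto elim!: degree_eq_zeroE simp: monom_0)
      then show ?thesis by (simp add: polys_over_closed[OF ai])
    next
      case False
      have "degree h' < degree h"
      proof (rule degree_lessI)
        show "\<forall>k\<ge>degree h. coeff h' k = 0" by (auto simp: h'_def a_def n_def coeff_eq_0)
      qed (use False n_def in auto)
      then show ?thesis using less.hyps prem by blast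
    qed
    then have "h' + monom a n \<in> polys_over ?Z" using a by (intro polys_over_closed[OF ai])
    then show ?thesis by (simp add: h'_def)
  qed (simp add: polys_over_closed[OF ai])
qed

text \<open>Dividing out the linear factors of the roots outside \<open>S\<close> leaves a
  polynomial with algebraic integer coefficients whose constant term is \<open>a * \<Prod>S\<close>
  up to sign.\<close>

lemma algebraic_int_lead_coeff_times_prod_roots:
  assumes "finite Z" "smult a (\<Prod>z\<in>Z. [:- z, 1:]) \<in> polys_over {x. algebraic_int x}" "S \<subseteq> Z"
  shows "algebraic_int (a * \<Prod>S)"
proof -
  have "smult a (\<Prod>z\<in>S \<union> T. [:- z, 1:]) \<in> polys_over {x. algebraic_int x} \<Longrightarrow>
        smult a (\<Prod>z\<in>S. [:- z, 1:]) \<in> polys_over {x. algebraic_int x}" if "finite T" "S \<inter> T = {}" "finite S" for T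
    using that
  proof (induction T)
    case (insert t T)
    have "smult a (\<Prod>z\<in>S \<union> insert t T. [:- z, 1:]) = [:- t, 1:] * smult a (\<Prod>z\<in>S \<union> T. [:- z, 1:])"
      using insert by (simp del: mult_pCons_left)
    then have "smult a (\<Prod>z\<in>S \<union> T. [:- z, 1:]) \<in> polys_over {x. algebraic_int x}"
      using insert.prems(1) polys_over_algebraic_int_divide_linear by metis
    then show ?case using insert.IH insert.prems by blast
  qed simp
  from this[of "Z - S"] have "smult a (\<Prod>z\<in>S. [:- z, 1:]) \<in> polys_over {x. algebraic_int x}"
    using assms finite_subset[OF assms(3,1)] by (simp add: Un_absorb1)
  then have "coeff (smult a (\<Prod>z\<in>S. [:- z, 1:])) 0 \<in> {x. algebraic_int x}" by (rule polys_over_coeff)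
  moreover have "coeff (smult a (\<Prod>z\<in>S. [:- z, 1:])) 0 = a * (\<Prod>z\<in>S. - z)"
    by (simp add: poly_0_coeff_0[symmetric] poly_prod)
  moreover have "(\<Prod>z\<in>S. - z) = (- 1) ^ card S * \<Prod>S"
    using prod.distrib[of "\<lambda>_. - 1" "\<lambda>z. z" S] by simp
  ultimately have "algebraic_int (a * ((- 1) ^ card S * \<Prod>S))" by (simp only: mem_Collect_eq)
  then show ?thesis by (cases "even (card S)") auto
qed

text \<open>The multiplier is a leading coefficient; conversely, substituting \<open>k * X\<close>
  into a polynomial for \<open>k * x\<close> gives one for \<open>x\<close>. This transfers closure
  under sums and products from algebraic integers to algebraic numbers.\<close>

lemma algebraic_iff_multiple_algebraic_int:
  "algebraic (x :: complex) \<longleftrightarrow> (\<exists>k. k \<noteq> 0 \<and> algebraic_int (of_int k * x))"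
proof
  assume "algebraic x"
  then obtain p where p: "p \<noteq> 0" "poly (map_poly of_int p) x = 0" by (rule algebraicE')
  have "algebraic_int (lead_coeff (map_poly of_int p) * x)"
    using p by (intro algebraic_int_lead_coeff_times_root) (auto simp: polys_over_def)
  then show "\<exists>k. k \<noteq> 0 \<and> algebraic_int (of_int k * x)"
    using p by (intro exI[of _ "lead_coeff p"]) auto
next
  assume "\<exists>k. k \<noteq> 0 \<and> algebraic_int (of_int k * x)"
  then obtain k p where k: "k \<noteq> 0" and p: "lead_coeff p = 1" "\<forall>i. coeff p i \<in> \<int>" "poly p (of_int k * x) = 0"
    by (auto elim: algebraic_int.cases)
  show "algebraic x"
  proof (rule algebraicI)
    show "pcompose p [:0, of_int k:] \<noteq> 0" using p(1) k by (auto simp: pcompose_eq_0_iff)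
    show "poly (pcompose p [:0, of_int k:]) x = 0" using p(3) by (simp add: poly_pcompose mult.commute)
    show "coeff (pcompose p [:0, of_int k:]) i \<in> \<int>" for i
      using p(2) by (intro coeff_pcompose_semiring_closed) (auto simp: coeff_pCons split: nat.splits)
  qed
qed

lemma is_subring_C_algebraic: "is_subring_C {x. algebraic x}"
proof -
  note ai = is_subring_C_algebraic_int
  have "algebraic (x + y) \<and> algebraic (x * y)" if xy: "algebraic x" "algebraic y" for x y :: complex
  proof -
    obtain k l where k: "k \<noteq> 0" "of_int k * x \<in> {x. algebraic_int x}" and l: "l \<noteq> 0" "of_int l * y \<in> {x. algebraic_int x}"
      using xy[unfolded algebraic_iff_multiple_algebraic_int] by blast
    have "of_int l * (of_int k * x) + of_int k * (of_int l * y) \<in> {x. algebraic_int x}"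
      by (rule is_subring_CD(3)[OF ai is_subring_CD(4)[OF ai is_subring_C_of_int[OF ai] k(2)]
            is_subring_CD(4)[OF ai is_subring_C_of_int[OF ai] l(2)]])
    moreover have "(of_int k * x) * (of_int l * y) \<in> {x. algebraic_int x}"
      by (rule is_subring_CD(4)[OF ai k(2) l(2)])
    ultimately have "algebraic_int (of_int (k * l) * (x + y))" "algebraic_int (of_int (k * l) * (x * y))"
      by (simp_all add: algebra_simps)
    moreover have "k * l \<noteq> 0" using k l by simp
    ultimately show ?thesis unfolding algebraic_iff_multiple_algebraic_int by blast
  qed
  then show ?thesis by (auto simp: is_subring_C_def)
qed

section \<open>Minimal polynomials and Mahler measure\<close>

abbreviation vanishes :: "int poly \<Rightarrow> complex \<Rightarrow> bool" where
  "vanishes p x \<equiv> poly (map_poly of_int p) x = 0"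

text \<open>If \<open>p = c * d\<close> with \<open>c\<close> vanishing at \<open>x\<close>,
  minimality forces \<open>d\<close> to be constant, and a constant factor divides the content,
  which is 1.\<close>

lemma primitive_minimal_degree_irreducible:
  assumes p: "p \<noteq> 0" "vanishes p x" "content p = 1"
    and min: "\<And>q. q \<noteq> 0 \<Longrightarrow> vanishes q x \<Longrightarrow> degree p \<le> degree q"
  shows "irreducible p"
proof (rule irreducibleI)
  show "p \<noteq> 0" by fact
  have deg: "degree p > 0"
  proof (rule ccontr)
    assume "\<not> degree p > 0"
    then obtain c where "p = [:c:]" by (auto elim: degree_eq_zeroE)
    then show False using p(1,2) by simp
  qed
  then show "\<not> is_unit p" by (auto simp: is_unit_poly_iff)
  fix a b assume ab: "p = a * b"
  then have nz: "a \<noteq> 0" "b \<noteq> 0" using p(1) by auto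
  have unit: "is_unit d" if "c \<noteq> 0" "d \<noteq> 0" "p = c * d" "vanishes c x" for c d
  proof -
    have "degree p = degree c + degree d" using that by (simp add: degree_mult_eq)
    then have "degree d = 0" using min[OF that(1,4)] by simp
    then obtain e where e: "d = [:e:]" by (auto elim: degree_eq_zeroE)
    then have "[:e:] dvd p" using that(3) dvd_triv_right by metis
    then have "e dvd content p" by (simp add: const_poly_dvd_iff_dvd_content)
    then show ?thesis using p(3) e by (simp add: is_unit_const_poly_iff)
  qed
  have "vanishes a x \<or> vanishes b x" using p(2) ab by (simp add: hom_distribs)
  then show "is_unit a \<or> is_unit b" using unit[of a b] unit[of b a] nz ab by (auto simp: mult.commute)
qed

text \<open>Over the integers, division with remainder becomes pseudo-division, which scales
  \<open>q\<close> by a constant \<open>a\<close>. Since \<open>p\<close> is prime and not constant,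
  it cannot divide \<open>a\<close> and must divide \<open>q\<close>.\<close>

lemma irreducible_minimal_degree_dvd:
  assumes p: "irreducible p" "vanishes p x"
    and min: "\<And>q. q \<noteq> 0 \<Longrightarrow> vanishes q x \<Longrightarrow> degree p \<le> degree q"
    and q: "vanishes q x"
  shows "p dvd q"
proof -
  have p0: "p \<noteq> 0" using p(1) by auto
  obtain a s where as: "a \<noteq> 0" "smult a q = p * s + pseudo_mod q p"
    using pseudo_mod(1)[OF p0, of q] by blast
  have "pseudo_mod q p = smult a q - p * s" using as(2) by simp
  then have "vanishes (pseudo_mod q p) x" using q p(2) by (simp add: hom_distribs)
  then have "pseudo_mod q p = 0" using pseudo_mod(2)[OF p0, of q] min[of "pseudo_mod q p"] by linarith
  then have "p dvd [:a:] * q" using as(2) by simp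
  then have "p dvd [:a:] \<or> p dvd q"
    using irreducible_imp_prime_elem[OF p(1)] by (rule prime_elem_dvd_multD[rotated])
  moreover have "\<not> p dvd [:a:]"
  proof
    assume pa: "p dvd [:a:]"
    then have "degree p = 0" using dvd_imp_degree_le[OF pa] as(1) by simp
    then obtain c where "p = [:c:]" by (auto elim: degree_eq_zeroE)
    then show False using p(2) p0 by simp
  qed
  ultimately show ?thesis by simp
qed

text \<open>Justifies the definite description in \<open>min_int_poly\<close>: a polynomial of least
  degree, made primitive with positive leading coefficient, is irreducible and divides every other
  candidate; the cofactor is then a unit, and the signs make it 1.\<close>

lemma min_int_poly_unique_exists:
  assumes "algebraic x"
  obtains p where "irreducible p" "lead_coeff p > 0" "vanishes p x" "min_int_poly x = p"
    "\<And>q. vanishes q x \<Longrightarrow> p dvd q"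
proof -
  obtain r where r: "r \<noteq> 0" "vanishes r x" using assms by (rule algebraicE')
  define Q where "Q = (\<lambda>q. q \<noteq> 0 \<and> vanishes q x)"
  obtain q where q: "Q q" "\<And>q'. Q q' \<Longrightarrow> degree q \<le> degree q'"
    using ex_has_least_nat[of Q r degree] r unfolding Q_def by blast
  define p where "p = (if lead_coeff q > 0 then primitive_part q else - primitive_part q)"
  have q_eq: "q = smult (content q) (primitive_part q)" by simp
  have cq: "content q > 0" using q(1) normalize_content[of q] by (auto simp: Q_def abs_if split: if_splits)
  have lq: "lead_coeff q = content q * lead_coeff (primitive_part q)"
    using lead_coeff_smult[of "content q" "primitive_part q"] unfolding content_times_primitive_part .
  have lp: "lead_coeff p > 0"
  proof (cases "lead_coeff q > 0")
    case True
    then show ?thesis using lq cq unfolding p_def by (simp add: zero_less_mult_iff)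
  next
    case False
    moreover have "lead_coeff q \<noteq> 0" using q(1) by (simp add: Q_def)
    ultimately have "content q * lead_coeff (primitive_part q) < 0" using lq by linarith
    then show ?thesis using cq False unfolding p_def by (simp add: mult_less_0_iff)
  qed
  have "poly (map_poly of_int q) x = of_int (content q) * poly (map_poly of_int (primitive_part q)) x"
    by (subst q_eq) (simp only: of_int_hom.map_poly_hom_smult poly_smult)
  then have vp: "vanishes p x" using q(1) cq by (auto simp: p_def Q_def hom_distribs)
  have p0: "p \<noteq> 0" using lp by auto
  have cp: "content p = 1" using q(1) content_smult[of "- 1" "primitive_part q"] by (auto simp: p_def Q_def)
  have dp: "degree p = degree q" by (simp add: p_def)
  have min: "degree p \<le> degree q'" if "q' \<noteq> 0" "vanishes q' x" for q'
    using q(2)[of q'] that dp by (simp add: Q_def)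
  have irr: "irreducible p" by (rule primitive_minimal_degree_irreducible[OF p0 vp cp min])
  have dvd: "p dvd q'" if "vanishes q' x" for q'
    by (rule irreducible_minimal_degree_dvd[OF irr vp min that])
  have "min_int_poly x = p" unfolding min_int_poly_def
  proof (rule the_equality)
    show "irreducible p \<and> lead_coeff p > 0 \<and> vanishes p x" using irr lp vp by blast
    fix p' assume p': "irreducible p' \<and> lead_coeff p' > 0 \<and> vanishes p' x"
    then obtain k where k: "p' = p * k" using dvd by blast
    have "\<not> is_unit p" using irr by auto
    then have "is_unit k" using k p' irreducibleD by blast
    then obtain c where c: "k = [:c:]" "is_unit c" by (auto simp: is_unit_poly_iff)
    then have "c = 1 \<or> c = -1" by auto
    then show "p' = p" using k c(1) p' lp by auto
  qed
  then show thesis using that irr lp vp dvd by blast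
qed

lemma min_int_poly:
  assumes "algebraic x"
  shows "irreducible (min_int_poly x)" "lead_coeff (min_int_poly x) > 0"
    "vanishes (min_int_poly x) x" "vanishes q x \<Longrightarrow> min_int_poly x dvd q"
  using min_int_poly_unique_exists[OF assms] by metis+

lemma vanishes_imp_algebraic: "p \<noteq> 0 \<Longrightarrow> vanishes p x \<Longrightarrow> algebraic x"
  by (rule algebraicI[of "map_poly of_int p"]) auto

lemma conjugates_iff: "z \<in> conjugates x \<longleftrightarrow> vanishes (min_int_poly x) z"
  by (simp add: conjugates_def)

lemma min_int_poly_nz: "algebraic x \<Longrightarrow> min_int_poly x \<noteq> 0"
  using min_int_poly(2) by force

lemma conjugate_algebraic: "algebraic x \<Longrightarrow> z \<in> conjugates x \<Longrightarrow> algebraic z"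
  using vanishes_imp_algebraic min_int_poly_nz conjugates_iff by blast

text \<open>One irreducible polynomial dividing another differs from it by a unit, and positivity of
  both leading coefficients excludes \<open>-1\<close>.\<close>

lemma min_int_poly_conjugate:
  assumes "algebraic x" "z \<in> conjugates x"
  shows "min_int_poly z = min_int_poly x"
proof -
  have "algebraic z" using assms by (rule conjugate_algebraic)
  then have "min_int_poly z dvd min_int_poly x"
    using min_int_poly(4) assms(2) unfolding conjugates_iff by blast
  then obtain k where k: "min_int_poly x = min_int_poly z * k" by (rule dvdE)
  have "\<not> is_unit (min_int_poly z)" using min_int_poly(1)[OF \<open>algebraic z\<close>] by auto
  then have "is_unit k" using k min_int_poly(1)[OF assms(1)] irreducibleD by blast
  then obtain c where c: "k = [:c:]" "is_unit c" by (auto simp: is_unit_poly_iff)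
  then have "c = 1 \<or> c = -1" by auto
  then show ?thesis
    using k c(1) min_int_poly(2)[OF assms(1)] min_int_poly(2)[OF \<open>algebraic z\<close>] by auto
qed

lemma finite_conjugates: "algebraic x \<Longrightarrow> finite (conjugates x)"
  unfolding conjugates_def by (intro poly_roots_finite) (simp add: min_int_poly_nz)

text \<open>The roots are simple: a double root \<open>a\<close> would have the same minimal
  polynomial, which would divide its own derivative of smaller degree. Hence the product may range
  over the set of conjugates.\<close>

lemma min_int_poly_factorization:
  assumes "algebraic x"
  shows "map_poly of_int (min_int_poly x) =
    smult (of_int (lead_coeff (min_int_poly x))) (\<Prod>z\<in>conjugates x. [:- z, 1 :: complex:])"
proof -
  let ?f = "min_int_poly x" and ?F = "map_poly of_int (min_int_poly x) :: complex poly"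
  have "rsquarefree ?F"
    unfolding rsquarefree_roots
  proof (intro allI notI)
    fix a assume a: "poly ?F a = 0 \<and> poly (pderiv ?F) a = 0"
    then have "a \<in> conjugates x" by (simp add: conjugates_iff)
    then have alg: "algebraic a" and eq: "min_int_poly a = ?f"
      using assms conjugate_algebraic min_int_poly_conjugate by auto
    have "vanishes (pderiv ?f) a" using a by (simp add: of_int_hom.map_poly_pderiv)
    then have dvd: "?f dvd pderiv ?f" using min_int_poly(4)[OF alg] unfolding eq by blast
    have "degree ?f > 0"
    proof (rule ccontr)
      assume "\<not> degree ?f > 0"
      then obtain c where "?f = [:c:]" by (auto elim: degree_eq_zeroE)
      then show False using a min_int_poly_nz[OF assms] by simp
    qed
    then have "pderiv ?f \<noteq> 0" "degree (pderiv ?f) < degree ?f"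
      by (auto simp: pderiv_eq_0_iff degree_pderiv)
    then show False using dvd_imp_degree_le[OF dvd] by simp
  qed
  from complex_poly_decompose_rsquarefree[OF this]
  show ?thesis unfolding conjugates_def by simp
qed

section \<open>Mahler measure under products, powers of the variable and reversal\<close>

lemma mahler_measure_poly_1: "mahler_measure_poly 1 = 1"
  unfolding one_pCons by (subst mahler_measure_constant) simp

lemma mahler_measure_poly_prod:
  "mahler_measure_poly (\<Prod>i\<in>I. f i) = (\<Prod>i\<in>I. mahler_measure_poly (f i))"
proof (induction I rule: infinite_finite_induct)
  case (insert i I)
  then show ?case by (simp add: measure_eq_prod)
qed (simp_all add: mahler_measure_poly_1)

lemma mahler_measure_poly_prod_list:
  "mahler_measure_poly (prod_list fs) = prod_list (map mahler_measure_poly fs)"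
  by (induction fs) (simp_all add: measure_eq_prod mahler_measure_poly_1)

lemma mahler_measure_poly_smult: "mahler_measure_poly (smult c p) = cmod c * mahler_measure_poly p"
  using measure_eq_prod[of "[:c:]" p] by simp

lemma M_explicit:
  assumes "algebraic x"
  shows "M x = of_int (lead_coeff (min_int_poly x)) * (\<Prod>z\<in>conjugates x. max 1 (cmod z))"
  unfolding M_def mahler_measure_def min_int_poly_factorization[OF assms]
  using min_int_poly(2)[OF assms]
  by (simp add: mahler_measure_poly_smult mahler_measure_poly_prod)

text \<open>The source of the upper bounds on \<open>M\<close> for roots, inverses and norms:
  \<open>p\<close> is a multiple of the minimal polynomial of \<open>x\<close>, and passing to a
  divisor does not increase the measure of an integer polynomial.\<close>

lemma M_le_mahler_measure:
  assumes "p \<noteq> 0" "vanishes p x"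
  shows "M x \<le> mahler_measure p"
  unfolding M_def using assms min_int_poly(4)[OF vanishes_imp_algebraic[OF assms] assms(2)]
  by (intro mahler_measure_dvd)

lemma M_ge_1: "algebraic x \<Longrightarrow> M x \<ge> 1"
  unfolding M_def by (intro mahler_measure_poly_ge_1 min_int_poly_nz)

text \<open>For a linear factor, every root of \<open>X^n - a\<close> has absolute value
  \<open>root n (cmod a)\<close>, so the product of the \<open>n\<close> maxima is
  \<open>max 1 (cmod a)\<close>. The general case follows by splitting \<open>p\<close> into linear
  factors.\<close>

lemma mahler_measure_poly_pcompose_power:
  assumes "n > 0"
  shows "mahler_measure_poly (pcompose p (monom 1 n)) = mahler_measure_poly p"
proof -
  have lin: "mahler_measure_poly (pcompose [:- a, 1:] (monom 1 n)) = max 1 (cmod a)" for a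
  proof -
    let ?h = "pcompose [:- a, 1:] (monom 1 n)"
    let ?rs = "complex_roots_complex ?h"
    have h: "?h = monom 1 n + [:- a:]" by (simp add: pcompose_pCons)
    have deg: "degree ?h = n" unfolding h using assms
      by (subst degree_add_eq_left) (auto simp: degree_monom_eq)
    have lead: "lead_coeff ?h = 1" unfolding deg unfolding h using assms by (simp add: coeff_pCons split: nat.splits)
    have len: "length ?rs = n" using complex_roots(2)[of ?h] deg by simp
    have eq: "(\<Prod>a\<leftarrow>?rs. [:- a, 1:]) = ?h" using complex_roots(1)[of ?h] unfolding lead by simp
    have root: "cmod r = root n (cmod a)" if "r \<in> set ?rs" for r
    proof -
      have "poly (\<Prod>a\<leftarrow>?rs. [:- a, 1:]) r = 0" using that by (auto simp: poly_prod_list prod_list_zero_iff)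
      then have "poly ?h r = 0" unfolding eq .
      then have "r ^ n = a" unfolding h by (simp add: poly_monom)
      then have "cmod r ^ n = cmod a" by (metis norm_power)
      then show ?thesis using assms real_root_power_cancel[of n "cmod r"] by simp
    qed
    have "map (\<lambda>a. max 1 (cmod a)) ?rs = replicate n (max 1 (root n (cmod a)))"
      using root len by (intro replicate_eqI) auto
    then have "mahler_measure_poly ?h = max 1 (root n (cmod a)) ^ n"
      unfolding mahler_measure_poly_def lead by simp
    also have "\<dots> = max 1 (cmod a)"
      using assms by (auto simp: max_def real_root_ge_1_iff real_root_le_1_iff not_le)
    finally show ?thesis .
  qed
  have comp: "pcompose (prod_list fs) q = prod_list (map (\<lambda>f. pcompose f q) fs)" for fs and q :: "complex poly"
    by (induction fs) (simp_all add: pcompose_mult)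
  let ?as = "complex_roots_complex p"
  have p: "p = smult (lead_coeff p) (\<Prod>a\<leftarrow>?as. [:- a, 1:])" by (rule complex_roots(1)[symmetric])
  have "mahler_measure_poly (pcompose p (monom 1 n)) =
    cmod (lead_coeff p) * (\<Prod>a\<leftarrow>?as. mahler_measure_poly (pcompose [:- a, 1:] (monom 1 n)))"
    by (subst p) (simp add: pcompose_smult comp mahler_measure_poly_smult mahler_measure_poly_prod_list o_def del: pcompose_pCons)
  also have "\<dots> = mahler_measure_poly p" unfolding lin unfolding mahler_measure_poly_def ..
  finally show ?thesis .
qed

lemma M_root_le:
  assumes "algebraic x" "n > 0" "w ^ n = x"
  shows "algebraic w" "M w \<le> M x"
proof -
  let ?p = "pcompose (min_int_poly x) (monom 1 n)"
  have eq: "map_poly of_int ?p = pcompose (map_poly of_int (min_int_poly x)) (monom 1 n :: complex poly)"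
    by (simp add: of_int_hom.map_poly_pcompose)
  have nz: "?p \<noteq> 0" using assms min_int_poly_nz[OF assms(1)]
    by (auto simp: pcompose_eq_0_iff degree_monom_eq)
  have v: "vanishes ?p w" unfolding eq using min_int_poly(3)[OF assms(1)] assms(3)
    by (simp add: poly_pcompose poly_monom)
  show "algebraic w" using nz v by (rule vanishes_imp_algebraic)
  have "M w \<le> mahler_measure ?p" using nz v by (rule M_le_mahler_measure)
  also have "\<dots> = M x"
    unfolding M_def mahler_measure_def eq by (rule mahler_measure_poly_pcompose_power[OF assms(2)])
  finally show "M w \<le> M x" .
qed

text \<open>A linear factor reverses to \<open>1 - a X\<close>, with leading coefficient
  \<open>- a\<close> and root \<open>inverse a\<close>, so its measure
  \<open>cmod a * max 1 (cmod (inverse a))\<close> is again \<open>max 1 (cmod a)\<close>. For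
  \<open>a = 0\<close> the degree drops and the reversal is 1.\<close>

lemma mahler_measure_poly_reflect: "mahler_measure_poly (reflect_poly p) = mahler_measure_poly p"
proof -
  have lin: "mahler_measure_poly (reflect_poly [:- a, 1:]) = max 1 (cmod a)" for a
  proof (cases "a = 0")
    case True
    then show ?thesis by (simp add: reflect_poly_def pCons_one mahler_measure_poly_1)
  next
    case False
    then have "reflect_poly [:- a, 1:] = smult (- a) [:- inverse a, 1:]"
      by (simp add: reflect_poly_def)
    then have "mahler_measure_poly (reflect_poly [:- a, 1:]) = cmod a * max 1 (cmod (inverse a))"
      by (simp only: mahler_measure_poly_smult mahler_measure_factor) simp
    then show ?thesis using False by (simp add: max_def norm_inverse norm_divide field_simps)
  qed
  have refl: "reflect_poly (prod_list fs) = prod_list (map reflect_poly fs)" for fs :: "complex poly list"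
    by (induction fs) (simp_all add: reflect_poly_mult)
  let ?as = "complex_roots_complex p"
  have p: "p = smult (lead_coeff p) (\<Prod>a\<leftarrow>?as. [:- a, 1:])" by (rule complex_roots(1)[symmetric])
  have "mahler_measure_poly (reflect_poly p) =
    cmod (lead_coeff p) * (\<Prod>a\<leftarrow>?as. mahler_measure_poly (reflect_poly [:- a, 1:]))"
    by (subst p) (simp only: reflect_poly_smult refl mahler_measure_poly_smult mahler_measure_poly_prod_list o_def map_map)
  also have "\<dots> = mahler_measure_poly p" unfolding lin unfolding mahler_measure_poly_def ..
  finally show ?thesis .
qed

lemma M_inverse_le:
  assumes "algebraic x" "x \<noteq> 0"
  shows "M (inverse x) \<le> M x"
proof -
  let ?p = "reflect_poly (min_int_poly x)"
  have eq: "map_poly of_int ?p = reflect_poly (map_poly of_int (min_int_poly x) :: complex poly)"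
    by (rule poly_eqI) (simp add: coeff_reflect_poly coeff_map_poly)
  have "?p \<noteq> 0" using min_int_poly_nz[OF assms(1)] by simp
  moreover have "vanishes ?p (inverse x)" unfolding eq
    using min_int_poly(3)[OF assms(1)] assms(2) by (simp add: poly_reflect_poly_nz)
  ultimately have "M (inverse x) \<le> mahler_measure ?p" by (rule M_le_mahler_measure)
  also have "\<dots> = M x" unfolding M_def mahler_measure_def eq by (rule mahler_measure_poly_reflect)
  finally show ?thesis .
qed

lemma M_tor:
  assumes "z \<in> tor"
  shows "algebraic z" "M z = 1"
proof -
  obtain n where n: "n > 0" "z ^ n = 1" using assms by (auto simp: tor_def)
  have "M 1 \<le> mahler_measure [:- 1, 1:]" by (rule M_le_mahler_measure) auto
  also have "\<dots> = 1" using mahler_measure_factor[of 1] by (simp add: mahler_measure_def)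
  finally have "M 1 \<le> 1" .
  moreover show "algebraic z" by (rule M_root_le[of 1]) (use n in auto)
  ultimately show "M z = 1" using M_root_le(2)[of 1 n z] n M_ge_1[of z] by force
qed

section \<open>Automorphisms of the algebraic numbers\<close>

text \<open>A partial field embedding is encoded by its graph, so that Zorn's lemma applies to inclusion of relations.\<close>

definition partial_hom :: "(complex \<times> complex) set \<Rightarrow> bool" where
  "partial_hom R \<longleftrightarrow> (\<forall>r\<in>\<rat>. (r, r) \<in> R) \<and>
     (\<forall>a b c d. (a, b) \<in> R \<longrightarrow> (c, d) \<in> R \<longrightarrow> (a + c, b + d) \<in> R \<and> (a * c, b * d) \<in> R) \<and>
     (\<forall>b. (0, b) \<in> R \<longrightarrow> b = 0) \<and> (\<forall>a b. (a, b) \<in> R \<longrightarrow> algebraic a)"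

lemma partial_homD:
  assumes "partial_hom R"
  shows "r \<in> \<rat> \<Longrightarrow> (r, r) \<in> R" "(a, b) \<in> R \<Longrightarrow> (c, d) \<in> R \<Longrightarrow> (a + c, b + d) \<in> R"
    "(a, b) \<in> R \<Longrightarrow> (c, d) \<in> R \<Longrightarrow> (a * c, b * d) \<in> R" "(0, b) \<in> R \<Longrightarrow> b = 0" "(a, b) \<in> R \<Longrightarrow> algebraic a"
  using assms unfolding partial_hom_def by blast+

lemma partial_hom_minus: "partial_hom R \<Longrightarrow> (a, b) \<in> R \<Longrightarrow> (- a, - b) \<in> R"
  using partial_homD(3)[of R "- 1" "- 1" a b] partial_homD(1)[of R "- 1"] by simp

text \<open>Single-valuedness follows by applying the kernel condition of \<open>partial_hom\<close>
  to the difference of the two pairs.\<close>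

lemma partial_hom_unique:
  assumes "partial_hom R" "(a, b) \<in> R" "(a, c) \<in> R"
  shows "b = c"
  using partial_homD(2)[OF assms(1,2) partial_hom_minus[OF assms(1,3)]] partial_homD(4)[OF assms(1)]
  by fastforce

lemma partial_hom_sum:
  assumes "partial_hom R" "\<And>i. i \<in> I \<Longrightarrow> (f i, g i) \<in> R"
  shows "(sum f I, sum g I) \<in> R"
  using assms(2)
  by (induction I rule: infinite_finite_induct) (auto intro: partial_homD[OF assms(1)])

text \<open>The coefficientwise action of a partial embedding on polynomials, again encoded as a
  relation.\<close>

definition poly_rel :: "(complex \<times> complex) set \<Rightarrow> (complex poly \<times> complex poly) set" where
  "poly_rel R = {(p, q). \<forall>i. (coeff p i, coeff q i) \<in> R}"

lemma poly_rel_pCons_iff: "(pCons a p, pCons b q) \<in> poly_rel R \<longleftrightarrow> (a, b) \<in> R \<and> (p, q) \<in> poly_rel R"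
  unfolding poly_rel_def by (auto simp: coeff_pCons split: nat.splits)

lemma poly_rel_closed:
  assumes "partial_hom R"
  shows "(0, 0) \<in> poly_rel R" "(1, 1) \<in> poly_rel R"
    "(p, p') \<in> poly_rel R \<Longrightarrow> (q, q') \<in> poly_rel R \<Longrightarrow> (p + q, p' + q') \<in> poly_rel R"
    "(p, p') \<in> poly_rel R \<Longrightarrow> (q, q') \<in> poly_rel R \<Longrightarrow> (p * q, p' * q') \<in> poly_rel R"
  using partial_homD[OF assms] unfolding poly_rel_def
  by (auto simp: coeff_mult coeff_1 intro!: partial_hom_sum[OF assms])

lemma poly_rel_prod:
  assumes "partial_hom R" "\<And>i. i \<in> I \<Longrightarrow> (f i, g i) \<in> poly_rel R"
  shows "(prod f I, prod g I) \<in> poly_rel R"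
  using assms(2)
  by (induction I rule: infinite_finite_induct) (auto intro: poly_rel_closed[OF assms(1)])

lemma poly_rel_unique:
  assumes "partial_hom R" "(p, q) \<in> poly_rel R" "(p, q') \<in> poly_rel R"
  shows "q = q'"
proof (rule poly_eqI)
  show "coeff q n = coeff q' n" for n
    using assms(2,3) partial_hom_unique[OF assms(1), of "coeff p n"] by (simp add: poly_rel_def)
qed

lemma poly_rel_poly:
  assumes R: "partial_hom R" and "(p, q) \<in> poly_rel R" "(x, y) \<in> R"
  shows "(poly p x, poly q y) \<in> R"
  using assms(2)
proof (induction p arbitrary: q)
  case 0
  then have "q = 0" using poly_rel_unique[OF R _ poly_rel_closed(1)[OF R]] by blast
  then show ?case using partial_homD(1)[OF R, of 0] by simp
next
  case (pCons a p)
  obtain b q' where q: "q = pCons b q'" by (cases q) auto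
  then have "(a, b) \<in> R" "(poly p x, poly q' y) \<in> R" using pCons by (auto simp: poly_rel_pCons_iff)
  then show ?case using q assms(3) by (auto intro!: partial_homD[OF R])
qed

lemma poly_rel_ex:
  assumes R: "partial_hom R" and "p \<in> polys_over (Domain R)"
  shows "\<exists>q. (p, q) \<in> poly_rel R"
  using assms(2)
proof (induction p)
  case 0
  then show ?case using poly_rel_closed(1)[OF R] by blast
next
  case (pCons a p)
  have "a \<in> Domain R" using polys_over_coeff[OF pCons.prems, of 0] by simp
  moreover have "p \<in> polys_over (Domain R)"
    using polys_over_coeff[OF pCons.prems, of "Suc _"] by (auto simp: polys_over_def)
  ultimately show ?case using pCons.IH poly_rel_pCons_iff by blast
qed

lemma poly_rel_polys_over: "(p, q) \<in> poly_rel R \<Longrightarrow> p \<in> polys_over (Domain R)"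
  by (auto simp: poly_rel_def polys_over_def)

text \<open>An integer polynomial \<open>c + X * q\<close> with \<open>c \<noteq> 0\<close> that
  vanishes at \<open>x\<close> expresses \<open>inverse x\<close> as a polynomial in
  \<open>x\<close>. So domains of partial embeddings are fields although \<open>partial_hom\<close>
  does not mention inverses.\<close>

lemma is_subring_C_inverse:
  assumes S: "is_subring_C S" "\<rat> \<subseteq> S" and x: "x \<in> S" "algebraic x"
  shows "inverse x \<in> S"
proof (cases "x = 0")
  case True
  then show ?thesis using x by simp
next
  case False
  obtain p where p: "coeff p 0 \<noteq> 0" "poly (map_poly of_int p) x = 0"
    using algebraicE'_nonzero[OF x(2) False] by blast
  obtain c q where pq: "p = pCons c q" by (cases p) auto
  define Q :: "complex poly" where "Q = map_poly of_int q"
  have c: "c \<noteq> 0" using p(1) pq by simp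
  have "map_poly of_int p = pCons (of_int c) Q" unfolding pq Q_def by (cases "c = 0 \<and> q = 0") (auto simp: map_poly_pCons)
  then have eq: "of_int c + x * poly Q x = 0" using p(2) by simp
  have "Q \<in> polys_over S" using is_subring_C_of_int[OF S(1)] by (auto simp: Q_def polys_over_def)
  then have "poly Q x \<in> S" using S(1) x(1) polys_over_poly by blast
  moreover have "- inverse (of_int c) \<in> S" using S(2) by auto
  ultimately have "poly Q x * (- inverse (of_int c)) \<in> S" using is_subring_CD(4)[OF S(1)] by blast
  moreover have "inverse x = poly Q x * (- inverse (of_int c))"
    using eq False c by (simp add: field_simps eq_neg_iff_add_eq_0)
  ultimately show ?thesis by simp
qed

lemma is_subring_C_subfield: "is_subfield_C S \<Longrightarrow> is_subring_C S"
  by (auto simp: is_subfield_C_def is_subring_C_def)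

lemma Rats_subset_subfield: "is_subfield_C S \<Longrightarrow> \<rat> \<subseteq> S"
proof
  fix r :: complex assume S: "is_subfield_C S" and "r \<in> \<rat>"
  then obtain a b where r: "r = of_int a / of_int b" by (auto elim: Rats_cases')
  have "of_int a \<in> S" "inverse (of_int b) \<in> S"
    using is_subring_C_of_int[OF is_subring_C_subfield[OF S]] S by (auto simp: is_subfield_C_def)
  then show "r \<in> S" unfolding r divide_inverse using S by (auto simp: is_subfield_C_def)
qed

lemma is_subfield_C_Rats: "is_subfield_C \<rat>"
  by (auto simp: is_subfield_C_def)

lemma is_subfield_C_algebraic: "is_subfield_C {x. algebraic x}"
  using is_subring_C_algebraic by (auto simp: is_subring_C_def is_subfield_C_def)

lemma is_subring_C_Domain: "partial_hom R \<Longrightarrow> is_subring_C (Domain R)"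
  unfolding is_subring_C_def
proof (intro conjI ballI)
  assume R: "partial_hom R"
  show "0 \<in> Domain R" "1 \<in> Domain R" 
    using partial_homD(1)[OF R Rats_0] partial_homD(1)[OF R Rats_1] by auto
  fix x assume "x \<in> Domain R"
  then obtain x' where x': "(x, x') \<in> R" by blast
  then show "- x \<in> Domain R" using partial_hom_minus[OF R] by blast
  fix y assume "y \<in> Domain R"
  then obtain y' where y': "(y, y') \<in> R" by blast
  show "x + y \<in> Domain R" "x * y \<in> Domain R" using partial_homD(2,3)[OF R x' y'] by auto
qed

lemma is_subfield_C_Domain:
  assumes R: "partial_hom R"
  shows "is_subfield_C (Domain R)"
proof -
  have "\<rat> \<subseteq> Domain R" using partial_homD(1)[OF R] by blast
  then have "inverse x \<in> Domain R" if "x \<in> Domain R" for x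
    using is_subring_C_inverse[OF is_subring_C_Domain[OF R] _ that] that partial_homD(5)[OF R] by blast
  then show ?thesis using is_subring_C_Domain[OF R] by (auto simp: is_subfield_C_def is_subring_C_def)
qed

section \<open>Minimal polynomials over subfields and extension of embeddings\<close>

definition is_min_poly :: "complex set \<Rightarrow> complex \<Rightarrow> complex poly \<Rightarrow> bool" where
  "is_min_poly F x m \<longleftrightarrow> m \<in> polys_over F \<and> lead_coeff m = 1 \<and> poly m x = 0 \<and>
     (\<forall>p\<in>polys_over F. p \<noteq> 0 \<longrightarrow> poly p x = 0 \<longrightarrow> degree m \<le> degree p)"

lemma is_min_poly_ex:
  assumes F: "is_subfield_C F" and x: "algebraic x"
  obtains m where "is_min_poly F x m"
proof -
  note Fr = is_subring_C_subfield[OF F]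
  define Q where "Q = (\<lambda>p. p \<in> polys_over F \<and> p \<noteq> 0 \<and> poly p x = 0)"
  obtain r where r: "r \<noteq> 0" "poly (map_poly of_int r) x = 0" using x by (rule algebraicE')
  have "Q (map_poly of_int r)" using r is_subring_C_of_int[OF Fr] by (auto simp: Q_def polys_over_def)
  then obtain q where q: "Q q" "\<And>q'. Q q' \<Longrightarrow> degree q \<le> degree q'"
    using ex_has_least_nat[of Q "map_poly of_int r" degree] by blast
  define m where "m = smult (inverse (lead_coeff q)) q"
  have "inverse (lead_coeff q) \<in> F" using q(1) F by (auto simp: Q_def is_subfield_C_def polys_over_coeff)
  then have "m \<in> polys_over F" using q(1) polys_over_closed(7)[OF Fr] by (auto simp: m_def Q_def)
  then have "is_min_poly F x m" using q unfolding is_min_poly_def m_def Q_def by auto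
  then show thesis by (rule that)
qed

lemma is_min_poly_dvd:
  assumes F: "is_subring_C F" and m: "is_min_poly F x m" and p: "p \<in> polys_over F" "poly p x = 0"
  shows "\<exists>s\<in>polys_over F. p = m * s"
proof -
  obtain s r where sr: "s \<in> polys_over F" "r \<in> polys_over F" "p = m * s + r"
    "\<And>i. i \<ge> degree m \<Longrightarrow> coeff r i = 0"
    using polys_over_divide_monic[OF F p(1), of m] m unfolding is_min_poly_def by blast
  have "poly r x = 0" using sr(3) p(2) m by (simp add: is_min_poly_def)
  then have "r = 0" using sr(2,4) m unfolding is_min_poly_def by (metis leading_coeff_0_iff)
  then show ?thesis using sr by auto
qed

text \<open>The extension sends \<open>p(x)\<close> to \<open>q(x')\<close> for related
  \<open>p\<close> and \<open>q\<close>. If \<open>p(x) = 0\<close>, then \<open>m\<close> divides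
  \<open>p\<close>, so \<open>m'\<close> divides \<open>q\<close> and \<open>q(x') = 0\<close>; this
  is the kernel condition, which also makes the extension single-valued.\<close>

lemma partial_hom_extend:
  assumes R: "partial_hom R" and x: "algebraic x" and m: "is_min_poly (Domain R) x m"
    and m': "(m, m') \<in> poly_rel R" "poly m' x' = 0"
  shows "\<exists>R'. partial_hom R' \<and> R \<subseteq> R' \<and> (x, x') \<in> R'"
proof -
  define R' where "R' = {(poly p x, poly q x') | p q. (p, q) \<in> poly_rel R}"
  have R'I: "(a, b) \<in> R'" if "(p, q) \<in> poly_rel R" "a = poly p x" "b = poly q x'" for a b p q
    using that unfolding R'_def by blast
  have const: "([:a:], [:b:]) \<in> poly_rel R" if "(a, b) \<in> R" for a b
    using that poly_rel_closed(1)[OF R] by (simp add: poly_rel_pCons_iff)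
  have sub: "R \<subseteq> R'"
  proof safe
    fix a b assume "(a, b) \<in> R"
    then show "(a, b) \<in> R'" by (intro R'I[OF const]) auto
  qed
  have "([:0, 1:], [:0, 1:]) \<in> poly_rel R"
    using partial_homD(1)[OF R] poly_rel_closed(1,2)[OF R] by (simp add: poly_rel_pCons_iff)
  then have xx': "(x, x') \<in> R'" by (rule R'I) auto
  have "partial_hom R'"
    unfolding partial_hom_def
  proof (intro conjI allI impI ballI)
    show "(r, r) \<in> R'" if "r \<in> \<rat>" for r using sub partial_homD(1)[OF R that] by blast
  next
    fix a b c d assume "(a, b) \<in> R'" "(c, d) \<in> R'"
    then obtain p q p' q' where *: "(p, q) \<in> poly_rel R" "(p', q') \<in> poly_rel R"
      "a = poly p x" "b = poly q x'" "c = poly p' x" "d = poly q' x'" unfolding R'_def by blast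
    show "(a + c, b + d) \<in> R'" by (rule R'I[OF poly_rel_closed(3)[OF R *(1,2)]]) (use * in auto)
    show "(a * c, b * d) \<in> R'" by (rule R'I[OF poly_rel_closed(4)[OF R *(1,2)]]) (use * in auto)
  next
    fix b assume "(0, b) \<in> R'"
    then obtain p q where pq: "(p, q) \<in> poly_rel R" "poly p x = 0" "b = poly q x'"
      unfolding R'_def by force
    obtain s where s: "s \<in> polys_over (Domain R)" "p = m * s"
      using is_min_poly_dvd[OF is_subring_C_Domain[OF R] m poly_rel_polys_over[OF pq(1)] pq(2)] by blast
    obtain s' where "(s, s') \<in> poly_rel R" using poly_rel_ex[OF R s(1)] by blast
    then have "(p, m' * s') \<in> poly_rel R" unfolding s(2) using poly_rel_closed(4)[OF R m'(1)] by blast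
    then have "q = m' * s'" using poly_rel_unique[OF R pq(1)] by blast
    then show "b = 0" using pq(3) m'(2) by simp
  next
    fix a b assume "(a, b) \<in> R'"
    then obtain p q where pq: "(p, q) \<in> poly_rel R" "a = poly p x" unfolding R'_def by blast
    have "p \<in> polys_over {x. algebraic x}"
      using pq(1) partial_homD(5)[OF R] by (auto simp: poly_rel_def polys_over_def)
    then have "a \<in> {x. algebraic x}" unfolding pq(2) using x
      by (intro polys_over_poly[OF is_subring_C_algebraic]) auto
    then show "algebraic a" by simp
  qed
  then show ?thesis using sub xx' by blast
qed

text \<open>Zorn's lemma gives a maximal extension. For algebraic \<open>x\<close>, the image of its
  minimal polynomial has a complex root to which \<open>x\<close> can be sent, so maximality puts
  \<open>x\<close> into the domain.\<close>

lemma partial_hom_maximal: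
  assumes "partial_hom R0"
  shows "\<exists>R. partial_hom R \<and> R0 \<subseteq> R \<and> Domain R = {x. algebraic x}"
proof -
  define \<A> where "\<A> = {R. partial_hom R \<and> R0 \<subseteq> R}"
  have "\<exists>R\<in>\<A>. \<forall>X\<in>\<A>. R \<subseteq> X \<longrightarrow> X = R"
  proof (rule subset_Zorn_nonempty)
    show "\<A> \<noteq> {}" using assms by (auto simp: \<A>_def)
    fix \<C> assume C: "\<C> \<noteq> {}" "subset.chain \<A> \<C>"
    then have sub: "\<C> \<subseteq> \<A>" by (simp add: subset.chain_def)
    have ph: "partial_hom R" if "R \<in> \<C>" for R using that sub by (auto simp: \<A>_def)
    have "partial_hom (\<Union>\<C>)"
      unfolding partial_hom_def
    proof (intro conjI allI impI ballI)
      show "(r, r) \<in> \<Union>\<C>" if "r \<in> \<rat>" for r using that C(1) ph partial_homD(1) by blast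
      fix a b c d assume ab: "(a, b) \<in> \<Union>\<C>" and cd: "(c, d) \<in> \<Union>\<C>"
      obtain R1 R2 where R12: "R1 \<in> \<C>" "(a, b) \<in> R1" "R2 \<in> \<C>" "(c, d) \<in> R2" using ab cd by auto
      have "R1 \<subseteq> R2 \<or> R2 \<subseteq> R1" using C(2) R12(1,3) by (auto simp: subset_chain_def)
      then obtain R where R: "R \<in> \<C>" "(a, b) \<in> R" "(c, d) \<in> R" using R12 by auto
      show "(a + c, b + d) \<in> \<Union>\<C>" "(a * c, b * d) \<in> \<Union>\<C>"
        using R(1) partial_homD(2,3)[OF ph[OF R(1)] R(2,3)] by auto
    next
      show "b = 0" if "(0, b) \<in> \<Union>\<C>" for b using that ph partial_homD(4) by blast
      show "algebraic a" if "(a, b) \<in> \<Union>\<C>" for a b using that ph partial_homD(5) by blast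
    qed
    moreover have "R0 \<subseteq> \<Union>\<C>" using C(1) sub unfolding \<A>_def by blast
    ultimately show "\<Union>\<C> \<in> \<A>" by (simp add: \<A>_def)
  qed
  then obtain R where RA: "R \<in> \<A>" "\<forall>X\<in>\<A>. R \<subseteq> X \<longrightarrow> X = R" by (rule bexE)
  have R: "partial_hom R" "R0 \<subseteq> R" using RA(1) by (simp_all add: \<A>_def)
  have max: "X = R" if "partial_hom X" "R \<subseteq> X" for X
    using RA(2) that R(2) by (simp add: \<A>_def subset_trans[of R0 R X])
  have "x \<in> Domain R" if x: "algebraic x" for x
  proof -
    obtain m where m: "is_min_poly (Domain R) x m"
      using is_min_poly_ex[OF is_subfield_C_Domain[OF R(1)] x] by blast
    then have mD: "m \<in> polys_over (Domain R)" "lead_coeff m = 1" "poly m x = 0" by (auto simp: is_min_poly_def)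
    obtain m' where m': "(m, m') \<in> poly_rel R" using poly_rel_ex[OF R(1) mD(1)] by blast
    \<comment> \<open>The image \<open>m'\<close> keeps the coefficient 1 in degree
      \<open>degree m\<close>, hence is not constant and has a root.\<close>
    have "(coeff m (degree m), coeff m' (degree m)) \<in> R" using m' by (auto simp: poly_rel_def)
    then have "coeff m' (degree m) = 1"
      using mD(2) partial_hom_unique[OF R(1) _ partial_homD(1)[OF R(1), of 1]] by auto
    then have "degree m \<le> degree m'" by (intro le_degree) auto
    moreover have "degree m > 0" using mD(2,3) by (intro gr0I) (auto elim!: degree_eq_zeroE)
    ultimately have "\<not> constant (poly m')" by (simp add: constant_degree)
    then obtain x' where "poly m' x' = 0" using fundamental_theorem_of_algebra by blast
    then obtain R' where "partial_hom R'" "R \<subseteq> R'" "(x, x') \<in> R'"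
      using partial_hom_extend[OF R(1) x m m'] by blast
    then show ?thesis using max by blast
  qed
  then have "Domain R = {x. algebraic x}" using partial_homD(5)[OF R(1)] by blast
  then show ?thesis using R by blast
qed

text \<open>Elements of \<open>aut L\<close> are only constrained on the algebraic numbers; their values elsewhere are junk.\<close>

definition aut :: "complex set \<Rightarrow> (complex \<Rightarrow> complex) set" where
  "aut L = {\<sigma>. bij_betw \<sigma> {x. algebraic x} {x. algebraic x} \<and>
     (\<forall>x y. algebraic x \<longrightarrow> algebraic y \<longrightarrow> \<sigma> (x + y) = \<sigma> x + \<sigma> y \<and> \<sigma> (x * y) = \<sigma> x * \<sigma> y) \<and>
     (\<forall>x\<in>L. \<sigma> x = x)}"

text \<open>A maximal extension is defined on all algebraic numbers. It is injective as a field
  homomorphism, and surjective because it permutes the finite root set of each nonzero integer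
  polynomial.\<close>

lemma partial_hom_in_aut:
  assumes "partial_hom R0" and "\<And>x. x \<in> L \<Longrightarrow> (x, x) \<in> R0"
  shows "\<exists>\<sigma>\<in>aut L. \<forall>(a, b)\<in>R0. \<sigma> a = b"
proof -
  obtain R where R: "partial_hom R" "R0 \<subseteq> R" "Domain R = {x. algebraic x}"
    using partial_hom_maximal[OF assms(1)] by blast
  define \<sigma> where "\<sigma> a = (THE b. (a, b) \<in> R)" for a
  have eq: "\<sigma> a = b" if "(a, b) \<in> R" for a b
    unfolding \<sigma>_def using that partial_hom_unique[OF R(1)] by blast
  have in_R: "(a, \<sigma> a) \<in> R" if "algebraic a" for a
    using that R(3) eq by blast
  have root: "poly (map_poly of_int p) (\<sigma> a) = 0" if "algebraic a" "poly (map_poly of_int p) a = 0" for p a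
  proof -
    have "(map_poly of_int p, map_poly of_int p) \<in> poly_rel R"
      using partial_homD(1)[OF R(1)] by (auto simp: poly_rel_def)
    from poly_rel_poly[OF R(1) this in_R[OF that(1)]] show ?thesis
      using that(2) partial_homD(4)[OF R(1)] by simp
  qed
  have add: "\<sigma> (x + y) = \<sigma> x + \<sigma> y" and mult: "\<sigma> (x * y) = \<sigma> x * \<sigma> y" if "algebraic x" "algebraic y" for x y
    using eq partial_homD(2,3)[OF R(1) in_R[OF that(1)] in_R[OF that(2)]] by blast+
  have inj: "inj_on \<sigma> {x. algebraic x}"
  proof (rule inj_onI, rule ccontr)
    fix x y assume xy: "x \<in> {x. algebraic x}" "y \<in> {x. algebraic x}" "\<sigma> x = \<sigma> y" "x \<noteq> y"
    have "(- y, - \<sigma> y) \<in> R" using partial_hom_minus[OF R(1) in_R] xy by blast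
    then have "(x + - y, \<sigma> x + - \<sigma> y) \<in> R" using partial_homD(2)[OF R(1) in_R] xy by blast
    then have d: "(x - y, 0) \<in> R" using xy by simp
    have "algebraic (inverse (x - y))" using partial_homD(5)[OF R(1) d] by blast
    from partial_homD(3)[OF R(1) d in_R[OF this]] have "(1, 0) \<in> R" using xy by simp
    from partial_hom_unique[OF R(1) this partial_homD(1)[OF R(1) Rats_1]] show False by simp
  qed
  have "\<exists>a. algebraic a \<and> \<sigma> a = b" if b: "algebraic b" for b
  proof -
    obtain p where p: "p \<noteq> 0" "poly (map_poly of_int p) b = 0" using b by (rule algebraicE')
    define Z where "Z = {z :: complex. poly (map_poly of_int p) z = 0}"
    have Z: "finite Z" unfolding Z_def using p by (intro poly_roots_finite) simp
    have Za: "Z \<subseteq> {x. algebraic x}" using p(1) unfolding Z_def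
      by (auto intro!: algebraicI[of "map_poly of_int p"])
    have "\<sigma> ` Z \<subseteq> Z" using Za root unfolding Z_def by blast
    then have "\<sigma> ` Z = Z" using Z inj_on_subset[OF inj Za] endo_inj_surj by blast
    moreover have "b \<in> Z" using p by (simp add: Z_def)
    ultimately obtain a where "a \<in> Z" "b = \<sigma> a" by (metis imageE)
    then show ?thesis using Za by auto
  qed
  moreover have "algebraic (\<sigma> a)" if a: "algebraic a" for a
  proof -
    obtain p where p: "p \<noteq> 0" "poly (map_poly of_int p) a = 0" using a by (rule algebraicE')
    then show ?thesis using root[OF a p(2)] by (intro algebraicI[of "map_poly of_int p"]) auto
  qed
  ultimately have "bij_betw \<sigma> {x. algebraic x} {x. algebraic x}"
    using inj by (auto simp: bij_betw_def)
  moreover have "\<forall>x\<in>L. \<sigma> x = x" using assms(2) R(2) eq by blast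
  ultimately have "\<sigma> \<in> aut L" unfolding aut_def using add mult by blast
  then show ?thesis using R(2) eq by blast
qed

text \<open>If \<open>x\<close> were outside \<open>L\<close>, its minimal polynomial over
  \<open>L\<close> would have degree at least 2 and, being separable, a second root
  \<open>x'\<close>. The embedding fixing \<open>L\<close> and sending \<open>x\<close> to
  \<open>x'\<close> extends to an automorphism that moves \<open>x\<close>.\<close>

lemma fixed_field:
  assumes L: "is_subfield_C L" "L \<subseteq> {x. algebraic x}" and x: "algebraic x"
    and fixed: "\<And>\<sigma>. \<sigma> \<in> aut L \<Longrightarrow> \<sigma> x = x"
  shows "x \<in> L"
proof (rule ccontr)
  assume "x \<notin> L"
  note Lr = is_subring_C_subfield[OF L(1)]
  define R where "R = Id_on L"
  have R: "partial_hom R" "Domain R = L"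
    using is_subring_CD[OF Lr] L(2) Rats_subset_subfield[OF L(1)]
    unfolding partial_hom_def R_def by auto
  obtain m where m: "is_min_poly L x m" using is_min_poly_ex[OF L(1) x] by blast
  then have mD: "m \<in> polys_over L" "lead_coeff m = 1" "poly m x = 0"
    and min: "\<And>p. p \<in> polys_over L \<Longrightarrow> p \<noteq> 0 \<Longrightarrow> poly p x = 0 \<Longrightarrow> degree m \<le> degree p"
    by (auto simp: is_min_poly_def)
  have "(m, m) \<in> poly_rel R" using mD(1) by (auto simp: poly_rel_def polys_over_def R_def)
  obtain s where s: "m = [:- x, 1:] * s" using mD(3) by (auto simp: poly_eq_0_iff_dvd elim: dvdE)
  have s0: "s \<noteq> 0" using s mD(2) by auto
  have deg: "degree m = Suc (degree s)" unfolding s using s0 by (subst degree_mult_eq) auto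
  have "degree s \<noteq> 0"
  proof
    assume "degree s = 0"
    then obtain c where c: "s = [:c:]" by (auto elim: degree_eq_zeroE)
    have "c = 1" using mD(2) deg unfolding s c by simp
    then have "coeff m 0 = - x" unfolding s c by simp
    then have "- x \<in> L" using polys_over_coeff[OF mD(1)] by metis
    then show False using \<open>x \<notin> L\<close> is_subring_CD(5)[OF Lr] by fastforce
  qed
  \<comment> \<open>If \<open>x\<close> were also a root of the cofactor \<open>s\<close>, it would
    be a root of the derivative of \<open>m\<close>, which is nonzero and of smaller degree.\<close>
  have "poly s x \<noteq> 0"
  proof
    assume sx: "poly s x = 0"
    have "poly (pderiv m) x = 0" unfolding s by (simp add: pderiv_mult pderiv_pCons sx del: mult_pCons_left)
    moreover have "pderiv m \<noteq> 0" using deg by (simp add: pderiv_eq_0_iff)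
    ultimately have "degree m \<le> degree (pderiv m)" using min polys_over_closed(10)[OF Lr mD(1)] by blast
    then show False using deg by (simp add: degree_pderiv)
  qed
  moreover obtain x' where "poly s x' = 0"
    using fundamental_theorem_of_algebra[of s] \<open>degree s \<noteq> 0\<close> by (auto simp: constant_degree)
  ultimately have x': "x' \<noteq> x" "poly m x' = 0" unfolding s by auto
  obtain R' where R': "partial_hom R'" "R \<subseteq> R'" "(x, x') \<in> R'"
    using partial_hom_extend[OF R(1) x _ \<open>(m, m) \<in> poly_rel R\<close> x'(2)] m R(2) by blast
  have "(y, y) \<in> R'" if "y \<in> L" for y using R'(2) that by (auto simp: R_def)
  from partial_hom_in_aut[OF R'(1) this] obtain \<sigma>
    where \<sigma>: "\<sigma> \<in> aut L" "\<forall>(a, b)\<in>R'. \<sigma> a = b" by (rule bexE)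
  have "\<sigma> x = x'" using bspec[OF \<sigma>(2) R'(3)] by simp
  then show False using fixed[OF \<sigma>(1)] x'(1) by simp
qed

section \<open>Orbits and norms\<close>

lemma autD:
  assumes "\<sigma> \<in> aut L"
  shows "algebraic x \<Longrightarrow> algebraic (\<sigma> x)" "inj_on \<sigma> {x. algebraic x}" "\<sigma> ` {x. algebraic x} = {x. algebraic x}"
    "algebraic x \<Longrightarrow> algebraic y \<Longrightarrow> \<sigma> (x + y) = \<sigma> x + \<sigma> y"
    "algebraic x \<Longrightarrow> algebraic y \<Longrightarrow> \<sigma> (x * y) = \<sigma> x * \<sigma> y"
    "x \<in> L \<Longrightarrow> \<sigma> x = x"
  using assms unfolding aut_def bij_betw_def by auto

lemma aut_mono: "L \<subseteq> L' \<Longrightarrow> aut L' \<subseteq> aut L"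
  unfolding aut_def by auto

lemma aut_id: "(\<lambda>x. x) \<in> aut L"
  unfolding aut_def by (auto simp: bij_betw_def)

lemma aut_comp:
  assumes "\<sigma> \<in> aut L" "\<tau> \<in> aut L"
  shows "\<sigma> \<circ> \<tau> \<in> aut L"
proof -
  have "bij_betw (\<sigma> \<circ> \<tau>) {x. algebraic x} {x. algebraic x}"
    using assms unfolding aut_def by (intro bij_betw_trans) auto
  then show ?thesis using autD(1,4,5,6)[OF assms(1)] autD(1,4,5,6)[OF assms(2)]
    by (simp add: aut_def)
qed

lemma aut_inverse:
  assumes "\<sigma> \<in> aut L" "L \<subseteq> {x. algebraic x}"
  obtains \<tau> where "\<tau> \<in> aut L" "\<And>x. algebraic x \<Longrightarrow> \<tau> (\<sigma> x) = x" "\<And>x. algebraic x \<Longrightarrow> \<sigma> (\<tau> x) = x"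
proof -
  define \<tau> where "\<tau> = inv_into {x. algebraic x} \<sigma>"
  have bij: "bij_betw \<sigma> {x. algebraic x} {x. algebraic x}" using assms(1) by (simp add: aut_def)
  have left: "\<tau> (\<sigma> x) = x" if "algebraic x" for x
    unfolding \<tau>_def using that bij_betw_inv_into_left[OF bij] by simp
  have right: "\<sigma> (\<tau> x) = x" if "algebraic x" for x
    unfolding \<tau>_def using that bij_betw_inv_into_right[OF bij] by simp
  have bij': "bij_betw \<tau> {x. algebraic x} {x. algebraic x}" unfolding \<tau>_def by (rule bij_betw_inv_into[OF bij])
  then have alg: "algebraic (\<tau> x)" if "algebraic x" for x using that by (auto simp: bij_betw_def)
  have "\<tau> (x + y) = \<tau> x + \<tau> y \<and> \<tau> (x * y) = \<tau> x * \<tau> y" if "algebraic x" "algebraic y" for x y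
  proof -
    have "algebraic (\<tau> x + \<tau> y)" "algebraic (\<tau> x * \<tau> y)"
      using is_subring_CD(3,4)[OF is_subring_C_algebraic, of "\<tau> x" "\<tau> y"] alg that by auto
    then show ?thesis
      using left[of "\<tau> x + \<tau> y"] left[of "\<tau> x * \<tau> y"] autD(4,5)[OF assms(1) alg[OF that(1)] alg[OF that(2)]] right that
      by simp
  qed
  moreover have "\<tau> x = x" if "x \<in> L" for x using left[of x] autD(6)[OF assms(1) that] assms(2) that by auto
  ultimately have "\<tau> \<in> aut L" using bij' unfolding aut_def by blast
  then show thesis using left right that by blast
qed

lemma aut_prod:
  assumes "\<sigma> \<in> aut L" "1 \<in> L" "\<And>i. i \<in> I \<Longrightarrow> algebraic (f i)"
  shows "\<sigma> (prod f I) = (\<Prod>i\<in>I. \<sigma> (f i))"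
  using assms(3)
proof (induction I rule: infinite_finite_induct)
  case (insert i I)
  have "prod f I \<in> {x. algebraic x}" using insert.prems by (intro is_subring_C_prod[OF is_subring_C_algebraic]) auto
  then show ?case using insert autD(5)[OF assms(1)] by simp
qed (use autD(6)[OF assms(1,2)] in auto)

lemma algebraic_prod_list: "(\<And>x. x \<in> set xs \<Longrightarrow> algebraic x) \<Longrightarrow> algebraic (prod_list xs :: complex)"
  using is_subring_CD(4)[OF is_subring_C_algebraic] by (induction xs) auto

lemma prod_list_conv_prod_nth: "prod_list xs = (\<Prod>i<length xs. xs ! i)"
  by (induction xs) (simp_all add: prod.lessThan_Suc_shift del: prod.lessThan_Suc)

lemma aut_prod_list:
  assumes "\<sigma> \<in> aut L" "1 \<in> L" "\<And>x. x \<in> set xs \<Longrightarrow> algebraic x"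
  shows "\<sigma> (prod_list xs) = prod_list (map \<sigma> xs)"
  using assms(3)
proof (induction xs)
  case (Cons x xs)
  then show ?case using autD(5)[OF assms(1)] algebraic_prod_list[of xs] by simp
qed (use autD(6)[OF assms(1,2)] in auto)

text \<open>Makes the results on \<open>partial_hom\<close> and \<open>poly_rel\<close> available
  for automorphisms.\<close>

lemma partial_hom_graph:
  assumes "\<sigma> \<in> aut \<rat>"
  shows "partial_hom {(x, \<sigma> x) | x. algebraic x}"
  using autD(4,5,6)[OF assms] is_subring_CD(3,4)[OF is_subring_C_algebraic] rat_imp_algebraic
  unfolding partial_hom_def by force

lemma aut_conjugate:
  assumes \<sigma>: "\<sigma> \<in> aut \<rat>" and x: "algebraic x" and z: "z \<in> conjugates x"
  shows "\<sigma> z \<in> conjugates x"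
proof -
  let ?R = "{(x, \<sigma> x) | x. algebraic x}" and ?f = "map_poly of_int (min_int_poly x) :: complex poly"
  have "(?f, ?f) \<in> poly_rel ?R"
    using autD(6)[OF \<sigma>] by (auto simp: poly_rel_def)
  moreover have "(z, \<sigma> z) \<in> ?R" using conjugate_algebraic[OF x z] by auto
  ultimately have "(poly ?f z, poly ?f (\<sigma> z)) \<in> ?R" by (rule poly_rel_poly[OF partial_hom_graph[OF \<sigma>]])
  moreover have "poly ?f z = 0" using z by (simp add: conjugates_iff)
  ultimately show ?thesis using autD(6)[OF \<sigma>, of 0] by (auto simp: conjugates_iff)
qed

lemma self_conjugate: "algebraic x \<Longrightarrow> x \<in> conjugates x"
  by (simp add: conjugates_iff min_int_poly(3))

section \<open>Galois orbits and their products\<close>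

definition aut_orbit :: "complex set \<Rightarrow> complex \<Rightarrow> complex set" where
  "aut_orbit L x = (\<lambda>\<sigma>. \<sigma> x) ` aut L"

text \<open>For a field \<open>L\<close> of algebraic numbers and algebraic \<open>x\<close> this is
  the field norm from \<open>L(x)\<close> to \<open>L\<close>, as the orbit consists of the distinct
  conjugates of \<open>x\<close> over \<open>L\<close>.\<close>

definition aut_norm :: "complex set \<Rightarrow> complex \<Rightarrow> complex" where
  "aut_norm L x = \<Prod>(aut_orbit L x)"

lemma aut_orbitI: "\<sigma> \<in> aut L \<Longrightarrow> \<sigma> x \<in> aut_orbit L x"
  unfolding aut_orbit_def by (rule imageI)

lemma aut_orbitE:
  assumes "y \<in> aut_orbit L x"
  obtains \<sigma> where "\<sigma> \<in> aut L" "y = \<sigma> x"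
  using assms unfolding aut_orbit_def by (rule imageE)

context
  fixes L :: "complex set"
  assumes L: "is_subfield_C L" "L \<subseteq> {x. algebraic x}"
begin

lemma aut_subset_aut_Rats: "aut L \<subseteq> aut \<rat>"
  by (rule aut_mono[OF Rats_subset_subfield[OF L(1)]])

lemma aut_orbit_self: "x \<in> aut_orbit L x"
  using aut_orbitI[OF aut_id] .

lemma aut_orbit_trans: "\<sigma> \<in> aut L \<Longrightarrow> y \<in> aut_orbit L x \<Longrightarrow> \<sigma> y \<in> aut_orbit L x"
  using aut_orbitI[OF aut_comp] by (auto elim!: aut_orbitE)

lemma aut_orbit_eq:
  assumes x: "algebraic x" and y: "y \<in> aut_orbit L x"
  shows "aut_orbit L y = aut_orbit L x"
proof
  show "aut_orbit L y \<subseteq> aut_orbit L x"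
    using aut_orbit_trans[OF _ y] by (auto elim!: aut_orbitE)
  obtain \<sigma> where \<sigma>: "\<sigma> \<in> aut L" "y = \<sigma> x" using y by (rule aut_orbitE)
  obtain \<tau> where \<tau>: "\<tau> \<in> aut L" "\<tau> (\<sigma> x) = x" using aut_inverse[OF \<sigma>(1) L(2)] x by metis
  have "x \<in> aut_orbit L y" using aut_orbitI[OF \<tau>(1), of y] \<sigma>(2) \<tau>(2) by simp
  then show "aut_orbit L x \<subseteq> aut_orbit L y"
    using aut_orbit_trans by (auto elim!: aut_orbitE[of _ L x])
qed

lemma aut_orbit_conjugates:
  assumes x: "algebraic x" and z: "z \<in> conjugates x"
  shows "aut_orbit L z \<subseteq> conjugates x"
  using aut_conjugate[OF _ x z] aut_subset_aut_Rats by (auto simp: aut_orbit_def)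

lemma finite_aut_orbit: "algebraic x \<Longrightarrow> finite (aut_orbit L x)"
  using aut_orbit_conjugates[OF _ self_conjugate] finite_conjugates finite_subset by blast

lemma aut_orbit_algebraic: "algebraic x \<Longrightarrow> y \<in> aut_orbit L x \<Longrightarrow> algebraic y"
  using autD(1) by (auto simp: aut_orbit_def)

lemma aut_image_orbit:
  assumes x: "algebraic x" and \<sigma>: "\<sigma> \<in> aut L"
  shows "\<sigma> ` aut_orbit L x = aut_orbit L x"
proof (rule endo_inj_surj)
  show "finite (aut_orbit L x)" by (rule finite_aut_orbit[OF x])
  show "\<sigma> ` aut_orbit L x \<subseteq> aut_orbit L x" using aut_orbit_trans[OF \<sigma>] by blast
  show "inj_on \<sigma> (aut_orbit L x)"
    using aut_orbit_algebraic[OF x] by (intro inj_on_subset[OF autD(2)[OF \<sigma>]]) auto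
qed

lemma aut_prod_set:
  assumes \<sigma>: "\<sigma> \<in> aut \<rat>" and A: "A \<subseteq> {x. algebraic x}"
  shows "\<sigma> (\<Prod>A) = \<Prod>(\<sigma> ` A)"
proof -
  have "\<sigma> (\<Prod>A) = (\<Prod>a\<in>A. \<sigma> a)" using A by (intro aut_prod[OF \<sigma>]) auto
  also have "\<dots> = \<Prod>(\<sigma> ` A)"
    using prod.reindex[OF inj_on_subset[OF autD(2)[OF \<sigma>] A], of "\<lambda>x. x"] by simp
  finally show ?thesis .
qed

lemma aut_norm_algebraic: "algebraic x \<Longrightarrow> algebraic (aut_norm L x)"
  using is_subring_C_prod[OF is_subring_C_algebraic, of "aut_orbit L x" "\<lambda>x. x"] aut_orbit_algebraic
  by (auto simp: aut_norm_def)

text \<open>Automorphisms over \<open>L\<close> permute the orbit, so its product is fixed and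
  \<open>fixed_field\<close> applies.\<close>

lemma aut_norm_in: 
  assumes x: "algebraic x"
  shows "aut_norm L x \<in> L"
proof (rule fixed_field[OF L aut_norm_algebraic[OF x]])
  fix \<sigma> assume \<sigma>: "\<sigma> \<in> aut L"
  have "\<sigma> (aut_norm L x) = \<Prod>(\<sigma> ` aut_orbit L x)" unfolding aut_norm_def
    using \<sigma> aut_subset_aut_Rats aut_orbit_algebraic[OF x] by (intro aut_prod_set) auto
  then show "\<sigma> (aut_norm L x) = aut_norm L x" using aut_image_orbit[OF x \<sigma>] by (simp add: aut_norm_def)
qed

lemma aut_norm_nz: 
  assumes x: "algebraic x" "x \<noteq> 0"
  shows "aut_norm L x \<noteq> 0"
proof -
  have "\<sigma> x \<noteq> 0" if "\<sigma> \<in> aut L" for \<sigma>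
    using inj_onD[OF autD(2)[OF that], of x 0] autD(6)[OF that, of 0] x L(1)
    by (auto simp: is_subfield_C_def)
  then show ?thesis using finite_aut_orbit[OF x(1)] by (auto simp: aut_norm_def aut_orbit_def)
qed

text \<open>Each element of the orbit of the tuple \<open>xs\<close> still multiplies to the fixed element \<open>prod_list xs\<close>;
  projecting the orbit to a coordinate covers the orbit of that coordinate evenly.\<close>

lemma aut_norm_prod_list:
  assumes xs: "\<And>x. x \<in> set xs \<Longrightarrow> algebraic x" and a: "prod_list xs \<in> L"
  obtains m e where "m > 0" "prod_list xs ^ m = (\<Prod>i<length xs. aut_norm L (xs ! i) ^ e i)"
proof -
  \<comment> \<open>The orbit of the whole tuple; its size becomes the exponent
    \<open>m\<close>.\<close>
  define T where "T = (\<lambda>\<sigma>. map \<sigma> xs) ` aut L"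
  have "\<sigma> x \<in> (\<Union>x\<in>set xs. aut_orbit L x)" if "\<sigma> \<in> aut L" "x \<in> set xs" for \<sigma> x
    using aut_orbitI[OF that(1), of x] that(2) by blast
  then have "T \<subseteq> {ys. set ys \<subseteq> (\<Union>x\<in>set xs. aut_orbit L x) \<and> length ys = length xs}"
    by (auto simp: T_def)
  moreover have "finite (\<Union>x\<in>set xs. aut_orbit L x)" using finite_aut_orbit[OF xs] by auto
  ultimately have finT: "finite T" using finite_lists_length_eq finite_subset by blast
  have "xs \<in> T" unfolding T_def using aut_id by force
  then have card: "card T > 0" using finT by (auto simp: card_gt_0_iff)
  have L1: "1 \<in> L" using L(1) by (simp add: is_subfield_C_def)
  have prodT: "prod_list t = prod_list xs" if "t \<in> T" for t
    using that aut_prod_list[OF _ L1, of _ xs] xs autD(6)[OF _ a] by (auto simp: T_def)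
  have lenT: "length t = length xs" if "t \<in> T" for t using that by (auto simp: T_def)
  have mapT: "map \<tau> t \<in> T" if "\<tau> \<in> aut L" "t \<in> T" for t \<tau>
    using that aut_comp[OF that(1)] by (force simp: T_def)
  define fib where "fib i y = {t \<in> T. t ! i = y}" for i y
  \<comment> \<open>Applying \<open>\<tau>\<close> entrywise injects the fibre over \<open>y\<close>
    into the fibre over \<open>\<tau> y\<close>. Moving along the orbit in both directions then
    shows that all fibres over it have equal size, which becomes the exponent
    \<open>e i\<close>.\<close>
  have card_le: "card (fib i y) \<le> card (fib i (\<tau> y))" if "\<tau> \<in> aut L" "i < length xs" for i y \<tau>
  proof (rule card_inj_on_le[where f = "map \<tau>"])
    show "finite (fib i (\<tau> y))" using finT by (simp add: fib_def)
    show "map \<tau> ` fib i y \<subseteq> fib i (\<tau> y)" using mapT[OF that(1)] lenT that(2) by (auto simp: fib_def)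
    have "set t \<subseteq> {x. algebraic x}" if "t \<in> T" for t using that xs autD(1) by (auto simp: T_def)
    then have "fib i y \<subseteq> lists {x. algebraic x}" by (auto simp: fib_def)
    then show "inj_on (map \<tau>) (fib i y)"
      using inj_on_mapI[OF inj_on_subset[OF autD(2)[OF that(1)]], of "fib i y"] by (auto simp: lists_eq_set)
  qed
  have fibre: "card (fib i y) = card (fib i (xs ! i))" if i: "i < length xs" and y: "y \<in> aut_orbit L (xs ! i)" for i y
  proof (rule antisym)
    have alg: "algebraic (xs ! i)" using xs i by simp
    obtain \<tau> where "\<tau> \<in> aut L" "y = \<tau> (xs ! i)" using y by (auto simp: aut_orbit_def)
    then show "card (fib i (xs ! i)) \<le> card (fib i y)" using card_le i by blast
    have "xs ! i \<in> aut_orbit L y" using aut_orbit_eq[OF alg y] aut_orbit_self by blast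
    then obtain \<tau> where "\<tau> \<in> aut L" "xs ! i = \<tau> y" by (auto simp: aut_orbit_def)
    then show "card (fib i y) \<le> card (fib i (xs ! i))" using card_le i by metis
  qed
  have coord: "(\<Prod>t\<in>T. t ! i) = aut_norm L (xs ! i) ^ card (fib i (xs ! i))" if i: "i < length xs" for i
  proof -
    have alg: "algebraic (xs ! i)" using xs i by simp
    have "(\<lambda>t. t ! i) ` T \<subseteq> aut_orbit L (xs ! i)" using i by (auto simp: T_def aut_orbit_def)
    then have "(\<Prod>t\<in>T. t ! i) = (\<Prod>y\<in>aut_orbit L (xs ! i). \<Prod>t\<in>fib i y. t ! i)"
      unfolding fib_def using prod.group[OF finT finite_aut_orbit[OF alg], of "\<lambda>t. t ! i" "\<lambda>t. t ! i"] by simp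
    also have "\<dots> = (\<Prod>y\<in>aut_orbit L (xs ! i). y ^ card (fib i (xs ! i)))"
    proof (rule prod.cong)
      fix y assume y: "y \<in> aut_orbit L (xs ! i)"
      have "(\<Prod>t\<in>fib i y. t ! i) = (\<Prod>t\<in>fib i y. y)" by (rule prod.cong) (auto simp: fib_def)
      then show "(\<Prod>t\<in>fib i y. t ! i) = y ^ card (fib i (xs ! i))" using fibre[OF i y] by simp
    qed simp
    finally show ?thesis by (simp add: aut_norm_def prod_power_distrib)
  qed
  have "prod_list xs ^ card T = (\<Prod>t\<in>T. prod_list t)" using prodT by simp
  also have "\<dots> = (\<Prod>t\<in>T. \<Prod>i<length xs. t ! i)"
    using lenT by (intro prod.cong) (auto simp: prod_list_conv_prod_nth)
  also have "\<dots> = (\<Prod>i<length xs. \<Prod>t\<in>T. t ! i)" by (rule prod.swap)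
  also have "\<dots> = (\<Prod>i<length xs. aut_norm L (xs ! i) ^ card (fib i (xs ! i)))" using coord by simp
  finally show thesis by (rule that[OF card])
qed

section \<open>Norms to a normal field\<close>

context
  assumes normal: "\<And>\<sigma>. \<sigma> \<in> aut \<rat> \<Longrightarrow> \<sigma> ` L \<subseteq> L"
begin

text \<open>\<open>\<sigma>'\<close> maps \<open>L\<close> into itself by normality,
  \<open>\<tau>\<close> acts trivially there, and \<open>\<sigma>\<close> undoes
  \<open>\<sigma>'\<close>. So \<open>aut L\<close> is stable under conjugation by arbitrary
  automorphisms.\<close>

lemma aut_normal:
  assumes \<sigma>: "\<sigma> \<in> aut \<rat>" and \<sigma>': "\<sigma>' \<in> aut \<rat>" "\<And>x. algebraic x \<Longrightarrow> \<sigma> (\<sigma>' x) = x" and \<tau>: "\<tau> \<in> aut L"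
  shows "\<sigma> \<circ> \<tau> \<circ> \<sigma>' \<in> aut L"
proof -
  have "\<sigma> \<circ> \<tau> \<circ> \<sigma>' \<in> aut \<rat>" using \<sigma> \<sigma>' \<tau> aut_subset_aut_Rats by (intro aut_comp) auto
  moreover have "(\<sigma> \<circ> \<tau> \<circ> \<sigma>') x = x" if "x \<in> L" for x
  proof -
    have "\<sigma>' x \<in> L" using normal[OF \<sigma>'(1)] that by blast
    then show ?thesis using autD(6)[OF \<tau>] \<sigma>'(2) that L(2) by auto
  qed
  ultimately show ?thesis by (auto simp: aut_def)
qed

text \<open>Conjugation moves \<open>\<sigma>\<close> past \<open>aut L\<close>, so arbitrary
  automorphisms carry orbits to orbits; this yields the Galois invariance of the polynomial in
  \<open>M_aut_norm_le\<close>.\<close>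

lemma aut_image_orbit_normal:
  assumes x: "algebraic x" and \<sigma>: "\<sigma> \<in> aut \<rat>"
  shows "\<sigma> ` aut_orbit L x = aut_orbit L (\<sigma> x)"
proof -
  have "\<rat> \<subseteq> {x :: complex. algebraic x}" using rat_imp_algebraic by auto
  then obtain \<sigma>' where \<sigma>': "\<sigma>' \<in> aut \<rat>" "\<And>x. algebraic x \<Longrightarrow> \<sigma>' (\<sigma> x) = x" "\<And>x. algebraic x \<Longrightarrow> \<sigma> (\<sigma>' x) = x"
    using aut_inverse[OF \<sigma>] by blast
  show ?thesis
  proof
    show "\<sigma> ` aut_orbit L x \<subseteq> aut_orbit L (\<sigma> x)"
    proof
      fix y assume "y \<in> \<sigma> ` aut_orbit L x"
      then obtain \<tau> where \<tau>: "\<tau> \<in> aut L" "y = \<sigma> (\<tau> x)" by (auto simp: aut_orbit_def)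
      then have "y = (\<sigma> \<circ> \<tau> \<circ> \<sigma>') (\<sigma> x)" using \<sigma>'(2)[OF x] by simp
      then show "y \<in> aut_orbit L (\<sigma> x)" using aut_normal[OF \<sigma> \<sigma>'(1,3) \<tau>(1)] unfolding aut_orbit_def by blast
    qed
    show "aut_orbit L (\<sigma> x) \<subseteq> \<sigma> ` aut_orbit L x"
    proof
      fix y assume "y \<in> aut_orbit L (\<sigma> x)"
      then obtain \<tau> where \<tau>: "\<tau> \<in> aut L" "y = \<tau> (\<sigma> x)" by (auto simp: aut_orbit_def)
      have "algebraic y" using \<tau> autD(1)[OF \<tau>(1)] autD(1)[OF \<sigma> x] by simp
      then have "y = \<sigma> ((\<sigma>' \<circ> \<tau> \<circ> \<sigma>) x)" using \<sigma>'(3) \<tau>(2) by simp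
      moreover have "(\<sigma>' \<circ> \<tau> \<circ> \<sigma>) x \<in> aut_orbit L x"
        using aut_normal[OF \<sigma>'(1) \<sigma> \<sigma>'(2) \<tau>(1)] unfolding aut_orbit_def by blast
      ultimately show "y \<in> \<sigma> ` aut_orbit L x" by blast
    qed
  qed
qed

lemma M_aut_norm_le:
  assumes x: "algebraic x"
  shows "M (aut_norm L x) \<le> M x"
proof -
  define A Z where "A = lead_coeff (min_int_poly x)" and "Z = conjugates x"
  define \<W> where "\<W> = aut_orbit L ` Z"
  define P :: "complex poly" where "P = smult (of_int A) (\<Prod>W\<in>\<W>. [:- \<Prod>W, 1:])"
  have A: "A > 0" using min_int_poly(2)[OF x] by (simp add: A_def)
  have finZ: "finite Z" using finite_conjugates[OF x] by (simp add: Z_def)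
  have algZ: "algebraic z" if "z \<in> Z" for z using conjugate_algebraic[OF x] that by (simp add: Z_def)
  have f: "map_poly of_int (min_int_poly x) = smult (of_int A) (\<Prod>z\<in>Z. [:- z, 1 :: complex:])"
    using min_int_poly_factorization[OF x] by (simp add: A_def Z_def)
  have orb_sub: "aut_orbit L z \<subseteq> Z" if "z \<in> Z" for z
    using aut_orbit_conjugates[OF x] that by (simp add: Z_def)
  have W_sub: "W \<subseteq> Z" if "W \<in> \<W>" for W using that orb_sub by (auto simp: \<W>_def)
  have fin\<W>: "finite \<W>" using finZ by (simp add: \<W>_def)
  have disj: "W \<inter> W' = {}" if WW': "W \<in> \<W>" "W' \<in> \<W>" "W \<noteq> W'" for W W'
  proof (rule ccontr)
    obtain z z' where z: "z \<in> Z" "W = aut_orbit L z" and z': "z' \<in> Z" "W' = aut_orbit L z'"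
      using WW'(1,2) by (auto simp: \<W>_def)
    assume "W \<inter> W' \<noteq> {}"
    then obtain y where y: "y \<in> aut_orbit L z" "y \<in> aut_orbit L z'" using z z' by auto
    from aut_orbit_eq[OF algZ[OF z(1)] y(1)] aut_orbit_eq[OF algZ[OF z'(1)] y(2)]
    show False using WW'(3) z(2) z'(2) by simp
  qed
  have Un: "\<Union>\<W> = Z" using W_sub aut_orbit_self by (auto simp: \<W>_def)
  note ai = is_subring_C_algebraic_int
  have "smult (of_int A) (\<Prod>z\<in>Z. [:- z, 1 :: complex:]) \<in> polys_over {x. algebraic_int x}"
    unfolding f[symmetric] by (auto simp: polys_over_def)
  then have int_prod: "algebraic_int (of_int A * \<Prod>S)" if "S \<subseteq> Z" for S
    by (rule algebraic_int_lead_coeff_times_prod_roots[OF finZ _ that])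
  \<comment> \<open>The extra factor \<open>\<Prod>S\<close> makes the induction work: expanding the
    linear factor of \<open>W\<close> either leaves \<open>S\<close> alone or moves \<open>W\<close>
    into it. The base case is that \<open>A\<close> times any product of distinct roots is an
    algebraic integer.\<close>
  have "smult (of_int A * \<Prod>S) (\<Prod>W\<in>\<P>. [:- \<Prod>W, 1:]) \<in> polys_over {x. algebraic_int x}"
    if "finite \<P>" "\<P> \<subseteq> \<W>" "S \<subseteq> Z" "S \<inter> \<Union>\<P> = {}" for \<P> S
    using that
  proof (induction \<P> arbitrary: S)
    case empty
    then show ?case using int_prod[of S] by (auto simp: polys_over_def coeff_pCons split: nat.splits)
  next
    case (insert W \<P>)
    let ?Q = "\<Prod>W\<in>\<P>. [:- \<Prod>W, 1 :: complex:]"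
    have "W \<inter> \<Union>\<P> = {}" using insert.prems(1) insert.hyps(2) disj[of W] by auto
    then have 1: "smult (of_int A * \<Prod>(S \<union> W)) ?Q \<in> polys_over {x. algebraic_int x}"
      using insert.prems W_sub by (intro insert.IH) auto
    have 2: "smult (of_int A * \<Prod>S) ?Q \<in> polys_over {x. algebraic_int x}"
      using insert.prems by (intro insert.IH) auto
    have "\<Prod>(S \<union> W) = \<Prod>S * \<Prod>W"
      using insert.prems W_sub[of W] finite_subset[OF _ finZ] by (intro prod.union_disjoint) auto
    then have "smult (of_int A * \<Prod>S) (\<Prod>W\<in>insert W \<P>. [:- \<Prod>W, 1:]) =
      pCons 0 (smult (of_int A * \<Prod>S) ?Q) - smult (of_int A * \<Prod>(S \<union> W)) ?Q"
      using insert.hyps by (simp add: smult_diff_right mult.assoc)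
    then show ?case using 1 2 polys_over_closed(4,8)[OF ai] is_subring_CD(1)[OF ai] by metis
  qed
  from this[OF fin\<W> order.refl, of "{}"] have P_int: "P \<in> polys_over {x. algebraic_int x}" by (simp add: P_def)
  have P_fixed: "\<sigma> (coeff P i) = coeff P i" if \<sigma>: "\<sigma> \<in> aut \<rat>" for \<sigma> i
  proof -
    let ?R = "{(x, \<sigma> x) | x. algebraic x}"
    note R = partial_hom_graph[OF \<sigma>]
    have img: "\<sigma> (\<Prod>W) = \<Prod>(\<sigma> ` W)" and algW: "algebraic (\<Prod>W)" if "W \<in> \<W>" for W
    proof -
      have W: "W \<subseteq> {x. algebraic x}" using W_sub[OF that] algZ by auto
      then show "\<sigma> (\<Prod>W) = \<Prod>(\<sigma> ` W)" by (rule aut_prod_set[OF \<sigma>])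
      show "algebraic (\<Prod>W)" using is_subring_C_prod[OF is_subring_C_algebraic, of W "\<lambda>x. x"] W by auto
    qed
    have "(\<lambda>W. \<sigma> ` W) ` \<W> \<subseteq> \<W>"
    proof safe
      fix W assume "W \<in> \<W>"
      then obtain z where z: "z \<in> Z" "W = aut_orbit L z" by (auto simp: \<W>_def)
      have "\<sigma> z \<in> Z" using aut_conjugate[OF \<sigma> x] z by (simp add: Z_def)
      then show "\<sigma> ` W \<in> \<W>" using aut_image_orbit_normal[OF algZ \<sigma>] z by (auto simp: \<W>_def)
    qed
    moreover have inj: "inj_on (\<lambda>W. \<sigma> ` W) \<W>"
    proof (rule inj_onI)
      fix W W' assume W: "W \<in> \<W>" "W' \<in> \<W>" "\<sigma> ` W = \<sigma> ` W'"
      have "W \<subseteq> {x. algebraic x}" "W' \<subseteq> {x. algebraic x}" using W_sub[OF W(1)] W_sub[OF W(2)] algZ by auto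
      then show "W = W'" using inj_on_image_eq_iff[OF autD(2)[OF \<sigma>]] W(3) by simp
    qed
    ultimately have bij: "(\<lambda>W. \<sigma> ` W) ` \<W> = \<W>" using fin\<W> endo_inj_surj by blast
    have AA: "(of_int A, of_int A) \<in> ?R" using autD(6)[OF \<sigma>, of "of_int A"] by auto
    have lin: "([:- \<Prod>W, 1:], [:- \<Prod>(\<sigma> ` W), 1:]) \<in> poly_rel ?R" if W: "W \<in> \<W>" for W
    proof -
      have "(\<Prod>W, \<Prod>(\<sigma> ` W)) \<in> ?R" using img[OF W] algW[OF W] by auto
      then have "(- \<Prod>W, - \<Prod>(\<sigma> ` W)) \<in> ?R" by (rule partial_hom_minus[OF R])
      moreover have "(1, 1) \<in> ?R" by (rule partial_homD(1)[OF R Rats_1])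
      ultimately show ?thesis using poly_rel_closed(1)[OF R] by (simp only: poly_rel_pCons_iff)
    qed
    \<comment> \<open>The scalar is written as a constant polynomial so that multiplicativity of
      \<open>poly_rel\<close> applies. The right-hand side is again \<open>P\<close> because
      \<open>\<sigma>\<close> permutes the orbits.\<close>
    have "([:of_int A:] * (\<Prod>W\<in>\<W>. [:- \<Prod>W, 1:]), [:of_int A:] * (\<Prod>W\<in>\<W>. [:- \<Prod>(\<sigma> ` W), 1:])) \<in> poly_rel ?R"
      using AA poly_rel_closed(1)[OF R]
      by (intro poly_rel_closed(4)[OF R] poly_rel_prod[OF R] lin) (simp_all only: poly_rel_pCons_iff)
    moreover have "(\<Prod>W\<in>\<W>. [:- \<Prod>(\<sigma> ` W), 1:]) = (\<Prod>W\<in>\<W>. [:- \<Prod>W, 1:])"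
      using prod.reindex[OF inj, of "\<lambda>W. [:- \<Prod>W, 1:]"] unfolding bij by (simp add: o_def)
    ultimately have "(P, P) \<in> poly_rel ?R" by (simp add: P_def)
    then have "(coeff P i, coeff P i) \<in> ?R" by (simp only: poly_rel_def mem_Collect_eq prod.case)
    then show ?thesis by auto
  qed
  have "coeff P i \<in> \<int>" for i
  proof (rule rational_algebraic_int_is_int)
    show int: "algebraic_int (coeff P i)" using polys_over_coeff[OF P_int] by auto
    show "coeff P i \<in> \<rat>"
      by (rule fixed_field[OF is_subfield_C_Rats]) (use rat_imp_algebraic int P_fixed in auto)
  qed
  then obtain p where p: "P = map_poly of_int p" by (elim intpolyE)
  have "P \<noteq> 0" using A fin\<W> by (simp add: P_def)
  then have "p \<noteq> 0" using p by auto
  moreover have "poly P (aut_norm L x) = 0"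
  proof -
    have "aut_orbit L x \<in> \<W>" using self_conjugate[OF x] by (simp add: \<W>_def Z_def)
    then have "(\<Prod>W\<in>\<W>. poly [:- \<Prod>W, 1:] (aut_norm L x)) = 0"
      using fin\<W> by (intro prod_zero) (auto simp: aut_norm_def)
    then show ?thesis by (simp add: P_def poly_prod)
  qed
  ultimately have "M (aut_norm L x) \<le> mahler_measure p" using p by (intro M_le_mahler_measure) auto
  also have "\<dots> = of_int A * (\<Prod>W\<in>\<W>. max 1 (cmod (\<Prod>W)))"
    unfolding mahler_measure_def p[symmetric] P_def using A
    by (simp add: mahler_measure_poly_smult mahler_measure_poly_prod)
  \<comment> \<open>Grouping roots can only lose: \<open>max 1\<close> of a product is at most the
    product of the \<open>max 1\<close>. As the orbits partition \<open>Z\<close>, the right-hand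
    side is the explicit formula for \<open>M x\<close>.\<close>
  also have "\<dots> \<le> of_int A * (\<Prod>W\<in>\<W>. \<Prod>z\<in>W. max 1 (cmod z))"
  proof (intro mult_left_mono prod_mono conjI)
    fix W assume "W \<in> \<W>"
    have "cmod (\<Prod>W) = (\<Prod>z\<in>W. cmod z)" by (rule prod_norm[symmetric])
    also have "\<dots> \<le> (\<Prod>z\<in>W. max 1 (cmod z))" by (intro prod_mono) auto
    finally show "max 1 (cmod (\<Prod>W)) \<le> (\<Prod>z\<in>W. max 1 (cmod z))" by (simp add: prod_ge_1)
  qed (use A in auto)
  also have "(\<Prod>W\<in>\<W>. \<Prod>z\<in>W. max 1 (cmod z)) = (\<Prod>z\<in>\<Union>\<W>. max 1 (cmod z))"
    using disj W_sub finite_subset[OF _ finZ] by (subst prod.Union_disjoint) auto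
  also have "of_int A * \<dots> = M x" unfolding Un using M_explicit[OF x] by (simp add: A_def Z_def)
  finally show ?thesis .
qed

end

end

section \<open>The quotient by torsion\<close>

lemma is_subfield_C_K: "is_subfield_C (K a)"
  unfolding K_def is_subfield_C_def by auto

lemma conjugates_subset_K: "conjugates a \<subseteq> K a"
  unfolding K_def by auto

lemma K_subset: "is_subfield_C S \<Longrightarrow> conjugates a \<subseteq> S \<Longrightarrow> K a \<subseteq> S"
  unfolding K_def by auto

lemma K_algebraic: "algebraic a \<Longrightarrow> K a \<subseteq> {x. algebraic x}"
  using conjugate_algebraic by (intro K_subset is_subfield_C_algebraic) auto

text \<open>The algebraic numbers that \<open>\<sigma>\<close> sends into \<open>K a\<close> form a
  subfield; it contains the conjugates of \<open>a\<close>, which \<open>\<sigma>\<close> maps among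
  themselves, and hence all of \<open>K a\<close>.\<close>

lemma K_normal:
  assumes a: "algebraic a" and \<sigma>: "\<sigma> \<in> aut \<rat>"
  shows "\<sigma> ` K a \<subseteq> K a"
proof -
  let ?S = "{x. algebraic x \<and> \<sigma> x \<in> K a}"
  note Ka = is_subfield_C_K[of a, unfolded is_subfield_C_def]
  note alg = is_subfield_C_algebraic[unfolded is_subfield_C_def]
  have rat: "\<sigma> r = r" if "r \<in> \<rat>" for r using autD(6)[OF \<sigma> that] .
  have "\<sigma> (- x) = - \<sigma> x" if "algebraic x" for x
    using autD(5)[OF \<sigma>, of "- 1" x] that rat[of "- 1"] by simp
  moreover have "\<sigma> (inverse x) = inverse (\<sigma> x)" if "algebraic x" for x
  proof (cases "x = 0")
    case False
    then have "\<sigma> x * \<sigma> (inverse x) = 1"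
      using autD(5)[OF \<sigma> that algebraic_inverse[OF that]] rat[of 1] by simp
    then show ?thesis by (simp add: inverse_unique)
  qed (use rat[of 0] in simp)
  ultimately have "is_subfield_C ?S"
    using Ka alg rat[of 0] rat[of 1] autD(4,5)[OF \<sigma>] by (simp add: is_subfield_C_def)
  moreover have "conjugates a \<subseteq> ?S"
    using aut_conjugate[OF \<sigma> a] conjugates_subset_K conjugate_algebraic[OF a] by auto
  ultimately have "K a \<subseteq> ?S" by (rule K_subset)
  then show ?thesis by auto
qed

lemma self_in_K: "algebraic a \<Longrightarrow> a \<in> K a"
  using self_conjugate conjugates_subset_K by blast

lemma complex_root_exists:
  assumes "n > 0"
  shows "\<exists>w :: complex. w ^ n = z"
proof -
  have "degree (monom 1 n + [:- z:]) = n"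
    using assms by (subst degree_add_eq_left) (auto simp: degree_monom_eq)
  then have "\<not> constant (poly (monom 1 n + [:- z:]))" using assms by (simp add: constant_degree)
  then obtain w where "poly (monom 1 n + [:- z:]) w = 0" using fundamental_theorem_of_algebra by blast
  then show ?thesis by (intro exI[of _ w]) (simp add: poly_monom)
qed

lemma tor_one: "1 \<in> tor"
  by (auto simp: tor_def)

lemma tor_mult: "x \<in> tor \<Longrightarrow> y \<in> tor \<Longrightarrow> x * y \<in> tor"
proof -
  assume "x \<in> tor" "y \<in> tor"
  then obtain m n where "m > 0" "x ^ m = 1" "n > 0" "y ^ n = 1" by (auto simp: tor_def)
  then have "m * n > 0" "(x * y) ^ (m * n) = 1"
    by (simp_all add: power_mult_distrib power_mult) (simp add: power_mult[symmetric] mult.commute[of m n] power_mult)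
  then show ?thesis unfolding tor_def by blast
qed

lemma tor_inverse: "x \<in> tor \<Longrightarrow> inverse x \<in> tor"
  by (auto simp: tor_def power_inverse)

lemma tor_power: "x \<in> tor \<Longrightarrow> x ^ n \<in> tor"
  by (induction n) (auto intro: tor_one tor_mult)

lemma tor_power_int: "x \<in> tor \<Longrightarrow> x powi k \<in> tor"
  by (auto simp: power_int_def intro: tor_power tor_inverse)

lemma tor_prod: "(\<And>i. i \<in> I \<Longrightarrow> f i \<in> tor) \<Longrightarrow> prod f I \<in> tor"
  by (induction I rule: infinite_finite_induct) (auto intro: tor_one tor_mult)

text \<open>In other words, the quotient by \<open>tor\<close> is torsion-free, so roots of classes
  are unique.\<close>

lemma tor_root:
  assumes "x ^ n \<in> tor" "n > 0"
  shows "x \<in> tor"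
proof -
  obtain m where "m > 0" "x ^ (n * m) = 1" using assms(1) by (auto simp: tor_def power_mult)
  then show ?thesis using assms(2) unfolding tor_def by (intro CollectI exI[of _ "n * m"]) simp
qed

lemma tor_nz: "x \<in> tor \<Longrightarrow> x \<noteq> 0"
  by (auto simp: tor_def power_0_left)

lemma piV_self: "x \<in> piV x"
  unfolding piV_def using tor_one by (intro image_eqI[of _ _ 1]) auto

lemma piV_iff: "x \<noteq> 0 \<Longrightarrow> y \<in> piV x \<longleftrightarrow> y / x \<in> tor"
  unfolding piV_def by (auto intro: image_eqI[of _ _ "y / x"])

lemma piV_subset: "y \<in> piV x \<Longrightarrow> piV y \<subseteq> piV x"
  unfolding piV_def using tor_mult by (force simp: mult.assoc[symmetric])

lemma piV_sym: "y \<in> piV x \<Longrightarrow> x \<in> piV y"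
proof -
  assume "y \<in> piV x"
  then obtain z where z: "z \<in> tor" "y = z * x" by (auto simp: piV_def)
  then have "x = inverse z * y" using tor_nz by simp
  then show ?thesis using tor_inverse[OF z(1)] unfolding piV_def by blast
qed

lemma piV_eq: "y \<in> piV x \<Longrightarrow> piV y = piV x"
  using piV_subset piV_sym by blast

lemma piV_mult: "a \<in> piV x \<Longrightarrow> b \<in> piV y \<Longrightarrow> a * b \<in> piV (x * y)"
proof -
  assume "a \<in> piV x" "b \<in> piV y"
  then obtain z w where "z \<in> tor" "w \<in> tor" "a = z * x" "b = w * y" by (auto simp: piV_def)
  then have "z * w \<in> tor" "a * b = (z * w) * (x * y)" using tor_mult by auto
  then show ?thesis unfolding piV_def by blast
qed

lemma piV_alg_units: "x \<in> alg_units \<Longrightarrow> y \<in> piV x \<Longrightarrow> y \<in> alg_units"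
  using M_tor(1) tor_nz is_subring_CD(4)[OF is_subring_C_algebraic] by (auto simp: piV_def alg_units_def)

section \<open>Measures of classes and products of numbers of small measure\<close>

lemma Mbar_V_le:
  assumes "x \<in> alg_units" "y \<in> piV x"
  shows "Mbar_V (piV x) \<le> M y"
proof -
  have "bdd_below (M ` piV x)"
    using piV_alg_units[OF assms(1)] M_ge_1 by (intro bdd_belowI[of _ 1]) (auto simp: alg_units_def)
  then show ?thesis unfolding Mbar_V_def using assms(2) by (intro cInf_lower) auto
qed

lemma Mbar_V_lessD:
  assumes "Mbar_V (piV x) < c"
  obtains y where "y \<in> piV x" "M y < c"
  using cInf_lessD[of "M ` piV x" c] assms piV_self[of x] unfolding Mbar_V_def by auto

text \<open>The multiplicative monoid generated by the numbers of measure at most \<open>c\<close>.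
  The empty list is allowed, so 1 always belongs to it.\<close>

definition small_prods :: "real \<Rightarrow> complex set" where
  "small_prods c = prod_list ` lists {g \<in> alg_units. M g \<le> c}"

lemma small_prods_1: "1 \<in> small_prods c"
  unfolding small_prods_def by (intro image_eqI[of _ _ "[]"]) auto

lemma small_prods_base: "g \<in> alg_units \<Longrightarrow> M g \<le> c \<Longrightarrow> g \<in> small_prods c"
  unfolding small_prods_def by (intro image_eqI[of _ _ "[g]"]) auto

lemma small_prods_mult: "x \<in> small_prods c \<Longrightarrow> y \<in> small_prods c \<Longrightarrow> x * y \<in> small_prods c"
proof -
  assume "x \<in> small_prods c" "y \<in> small_prods c"
  then obtain xs ys where "xs \<in> lists {g \<in> alg_units. M g \<le> c}" "ys \<in> lists {g \<in> alg_units. M g \<le> c}"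
    "x = prod_list xs" "y = prod_list ys" by (auto simp: small_prods_def)
  then show ?thesis unfolding small_prods_def by (intro image_eqI[of _ _ "xs @ ys"]) auto
qed

lemma small_prods_power: "x \<in> small_prods c \<Longrightarrow> x ^ n \<in> small_prods c"
  by (induction n) (auto intro: small_prods_1 small_prods_mult)

lemma small_prods_tor: "c \<ge> 1 \<Longrightarrow> z \<in> tor \<Longrightarrow> z \<in> small_prods c"
  using M_tor tor_nz by (intro small_prods_base) (auto simp: alg_units_def)

text \<open>The infimum provides a representative \<open>g\<close> of measure below
  \<open>c\<close>. Each element of the rational power is a root of unity times a power of
  \<open>w\<close>, a \<open>q\<close>-th root of \<open>g\<close> or of its inverse, and
  \<open>M w \<le> M g\<close>.\<close>

lemma vpow_subset_small_prods:
  assumes x: "x \<in> alg_units" and c: "Mbar_V (piV x) < c"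
  shows "vpow r (piV x) \<subseteq> small_prods c"
proof
  fix y assume "y \<in> vpow r (piV x)"
  define q p where "q = nat (snd (quotient_of r))" and "p = fst (quotient_of r)"
  have q: "q > 0" using quotient_of_denom_pos'[of r] by (simp add: q_def)
  obtain x' where x': "x' \<in> piV x" and y: "y \<noteq> 0" "y ^ q = x' powi p"
    using \<open>y \<in> vpow r (piV x)\<close> by (auto simp: vpow_def q_def p_def)
  obtain g where g: "g \<in> piV x" "M g < c" using Mbar_V_lessD[OF c] .
  have ga: "algebraic g" "g \<noteq> 0" using piV_alg_units[OF x g(1)] by (auto simp: alg_units_def)
  have "x' \<in> piV g" using piV_eq[OF g(1)] x' by simp
  then obtain z where z: "z \<in> tor" "x' = z * g" by (auto simp: piV_def)
  define h where "h = (if p \<ge> 0 then g else inverse g)"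
  have h: "algebraic h" "h \<noteq> 0" "M h \<le> M g" using ga M_inverse_le[OF ga] by (auto simp: h_def)
  have hp: "h ^ nat \<bar>p\<bar> = g powi p" by (auto simp: h_def power_int_def)
  obtain w where w: "w ^ q = h" using complex_root_exists[OF q] by blast
  have wa: "algebraic w" "M w \<le> M h" using M_root_le[OF h(1) q w] by auto
  have w0: "w \<noteq> 0" using w h(2) q by (auto simp: power_0_left)
  have "(y / w ^ nat \<bar>p\<bar>) ^ q = y ^ q / (w ^ q) ^ nat \<bar>p\<bar>"
    by (simp add: power_divide power_mult[symmetric] mult.commute)
  also have "\<dots> = z powi p" using y(2) z(2) ga(2) unfolding w hp by (simp add: power_int_mult_distrib)
  finally have "y / w ^ nat \<bar>p\<bar> \<in> tor" using tor_root[OF _ q] tor_power_int[OF z(1)] by simp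
  moreover have "c \<ge> 1" using g(2) M_ge_1[OF ga(1)] by simp
  ultimately have "y / w ^ nat \<bar>p\<bar> \<in> small_prods c" by (intro small_prods_tor)
  moreover have "w ^ nat \<bar>p\<bar> \<in> small_prods c"
    using wa w0 h(3) g(2) by (intro small_prods_power small_prods_base) (auto simp: alg_units_def)
  ultimately have "y / w ^ nat \<bar>p\<bar> * w ^ nat \<bar>p\<bar> \<in> small_prods c" by (rule small_prods_mult)
  then show "y \<in> small_prods c" using w0 by simp
qed

lemma set_prod_subset_small_prods:
  assumes "\<And>s. s \<in> t \<Longrightarrow> F s \<subseteq> small_prods c"
  shows "(\<Prod>s\<in>t. F s) \<subseteq> small_prods c"
  using assms
proof (induction t rule: infinite_finite_induct)
  case (insert s t)
  then have "F s \<subseteq> small_prods c" "prod F t \<subseteq> small_prods c" by auto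
  then show ?case using insert.hyps by (auto elim!: set_times_elim intro!: small_prods_mult)
qed (auto simp: small_prods_1)

lemma Max_M_ge_1: "xs \<noteq> [] \<Longrightarrow> set xs \<subseteq> alg_units \<Longrightarrow> Max (M ` set xs) \<ge> 1"
  using M_ge_1 by (intro Max_ge_iff[THEN iffD2]) (auto simp: alg_units_def neq_Nil_conv)

lemma M_inf_le:
  assumes "a \<in> small_prods c" "c \<ge> 1"
  shows "M_inf a \<le> c"
proof -
  obtain xs where xs: "set xs \<subseteq> {g \<in> alg_units. M g \<le> c}" "a = prod_list xs"
    using assms(1) by (auto simp: small_prods_def)
  have 1: "1 \<in> {g \<in> alg_units. M g \<le> c}" using M_tor[OF tor_one] assms(2) by (auto simp: alg_units_def)
  \<comment> \<open>The leading 1 makes the list nonempty, as \<open>M_inf\<close> demands, without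
    raising the maximum above \<open>c\<close>.\<close>
  have "M_inf a \<le> Max (M ` set (1 # xs))" unfolding M_inf_def
  proof (rule cInf_lower)
    show "Max (M ` set (1 # xs)) \<in> {Max (M ` set xs) |xs. xs \<noteq> [] \<and> set xs \<subseteq> alg_units \<and> a = prod_list xs}"
      using xs 1 by (intro CollectI exI[of _ "1 # xs"]) auto
    show "bdd_below {Max (M ` set xs) |xs. xs \<noteq> [] \<and> set xs \<subseteq> alg_units \<and> a = prod_list xs}"
      using Max_M_ge_1 by (intro bdd_belowI[of _ 1]) auto
  qed
  also have "\<dots> \<le> c" using xs(1) 1 by (intro Max.boundedI) auto
  finally show ?thesis .
qed

text \<open>Identifies the cosets occurring in \<open>vspan\<close>: it is enough to place a product
  of rational powers inside one coset and to exhibit an element of it.\<close>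

lemma tor_times_eq_piV:
  assumes "S \<subseteq> piV y" "S \<noteq> {}"
  shows "tor * S = piV y"
proof
  show "tor * S \<subseteq> piV y"
    using assms(1) tor_mult by (fastforce simp: piV_def mult.assoc[symmetric] elim!: set_times_elim)
  obtain x where x: "x \<in> S" using assms(2) by auto
  then have "piV y = piV x" using assms(1) piV_eq by auto
  also have "\<dots> \<subseteq> tor * S" using x by (auto simp: piV_def)
  finally show "piV y \<subseteq> tor * S" .
qed

text \<open>\<open>vpow\<close> uses the reduced fraction \<open>p / q\<close> of
  \<open>k / m\<close>, and the two are compared through \<open>p * m = k * q\<close>. Raising
  \<open>v / y\<close> to the power \<open>q * m\<close> leaves only a power of a root of
  unity.\<close>

lemma vpow_piV:
  assumes x: "x \<noteq> 0" and y: "y \<noteq> 0" and m: "m > 0" and eq: "y ^ m = x ^ k"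
  shows "vpow (of_nat k / of_nat m) (piV x) \<subseteq> piV y" "vpow (of_nat k / of_nat m) (piV x) \<noteq> {}"
proof -
  define r :: rat where "r = of_nat k / of_nat m"
  define q p where "q = nat (snd (quotient_of r))" and "p = fst (quotient_of r)"
  have q: "q > 0" using quotient_of_denom_pos'[of r] by (simp add: q_def)
  have "r = of_int p / of_nat q"
    using quotient_of_div[of r p "int q"] quotient_of_denom_pos'[of r] by (simp add: q_def p_def)
  then have "of_int (p * int m) = (of_int (int k * int q) :: rat)"
    using q m by (simp add: r_def field_simps)
  then have pm: "p * int m = int k * int q" by (simp only: of_int_eq_iff)
  then have "p \<ge> 0" using m by (metis mult_nonneg_nonneg of_nat_0_le_iff of_nat_0_less_iff zero_le_mult_iff not_less)
  then obtain n where p: "p = int n" by (metis nonneg_int_cases)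
  have nm: "n * m = k * q" using pm unfolding p by (metis of_nat_eq_iff of_nat_mult)
  have vpow: "vpow r c = {v. \<exists>u\<in>c. v \<noteq> 0 \<and> v ^ q = u ^ n}" for c
    using p by (auto simp: vpow_def q_def p_def)
  show "vpow (of_nat k / of_nat m) (piV x) \<subseteq> piV y"
  proof
    fix v assume "v \<in> vpow (of_nat k / of_nat m) (piV x)"
    then obtain z where z: "z \<in> tor" and v: "v \<noteq> 0" "v ^ q = (z * x) ^ n"
      unfolding r_def[symmetric] vpow by (auto simp: piV_def)
    have "(v / y) ^ (q * m) = (v ^ q) ^ m / (y ^ m) ^ q"
      by (simp add: power_divide power_mult[symmetric] mult.commute)
    also have "\<dots> = (z * x) ^ (n * m) / x ^ (k * q)" by (simp add: v(2) eq power_mult)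
    also have "\<dots> = z ^ (n * m)" using x unfolding nm by (simp add: power_mult_distrib)
    finally have "v / y \<in> tor" using tor_root[of "v / y" "q * m"] tor_power[OF z] q m by simp
    then show "v \<in> piV y" using piV_iff[OF y] by simp
  qed
  obtain v where v: "v ^ q = x ^ n" using complex_root_exists[OF q] by blast
  then have "v \<noteq> 0" using x q by (auto simp: power_0_left)
  then have "v \<in> vpow r (piV x)" unfolding vpow using v piV_self by auto
  then show "vpow (of_nat k / of_nat m) (piV x) \<noteq> {}" unfolding r_def by auto
qed

lemma set_prod_subset_piV:
  assumes "finite t" "\<And>s. s \<in> t \<Longrightarrow> F s \<subseteq> piV (y s) \<and> F s \<noteq> {}"
  shows "(\<Prod>s\<in>t. F s) \<subseteq> piV (\<Prod>s\<in>t. y s) \<and> (\<Prod>s\<in>t. F s) \<noteq> {}"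
  using assms
proof (induction t)
  case empty
  then show ?case using piV_self[of 1] by simp
next
  case (insert s t)
  then have *: "F s \<subseteq> piV (y s)" "prod F t \<subseteq> piV (prod y t)" "F s \<noteq> {}" "prod F t \<noteq> {}" by auto
  then have "F s * prod F t \<subseteq> piV (y s * prod y t)" by (auto elim!: set_times_elim intro!: piV_mult)
  moreover have "F s * prod F t \<noteq> {}" using *(3,4) by (auto simp: set_times_def)
  ultimately show ?case using insert.hyps by simp
qed

text \<open>Several \<open>\<beta> i\<close> may share a class, whereas \<open>vspan\<close> takes
  each class once. The exponents are therefore collected class by class in \<open>E\<close>, and
  \<open>y s\<close> is an \<open>m\<close>-th root of the resulting power of a representative
  \<open>x s\<close>.\<close>

lemma piV_in_vspan:
  fixes \<beta> :: "nat \<Rightarrow> complex"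
  assumes a: "a \<noteq> 0" and m: "m > 0" and eq: "a ^ m = (\<Prod>i<n. \<beta> i ^ e i)"
    and \<beta>: "\<And>i. i < n \<Longrightarrow> \<beta> i \<noteq> 0 \<and> piV (\<beta> i) \<in> S"
  shows "piV a \<in> vspan S"
proof -
  define t where "t = (\<lambda>i. piV (\<beta> i)) ` {..<n}"
  have "\<forall>s\<in>t. \<exists>i<n. s = piV (\<beta> i)" by (auto simp: t_def)
  then obtain idx where idx: "\<And>s. s \<in> t \<Longrightarrow> idx s < n \<and> s = piV (\<beta> (idx s))" by metis
  define x where "x s = \<beta> (idx s)" for s
  have x: "s = piV (x s)" "x s \<noteq> 0" if "s \<in> t" for s using idx[OF that] \<beta> by (auto simp: x_def)
  define E where "E s = (\<Sum>i\<in>{i\<in>{..<n}. piV (\<beta> i) = s}. e i)" for s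
  have "\<exists>y. y ^ m = x s ^ E s" for s by (rule complex_root_exists[OF m])
  then obtain y where y: "\<And>s. y s ^ m = x s ^ E s" by metis
  have y0: "y s \<noteq> 0" if "s \<in> t" for s using y[of s] x(2)[OF that] m by (auto simp: power_0_left)
  have pt: "piV (\<beta> i) \<in> t" if "i < n" for i using that by (auto simp: t_def)
  \<comment> \<open>The root of unity by which \<open>\<beta> i\<close> differs from the chosen
    representative of its class.\<close>
  define z where "z i = \<beta> i / x (piV (\<beta> i))" for i
  have z: "z i \<in> tor" if i: "i < n" for i
  proof -
    have "\<beta> i \<in> piV (x (piV (\<beta> i)))" using x(1)[OF pt[OF i]] piV_self by auto
    then show ?thesis using piV_iff[OF x(2)[OF pt[OF i]]] by (simp add: z_def)
  qed
  have "(\<Prod>i<n. x (piV (\<beta> i)) ^ e i) = (\<Prod>s\<in>t. \<Prod>i\<in>{i\<in>{..<n}. piV (\<beta> i) = s}. x (piV (\<beta> i)) ^ e i)"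
    unfolding t_def by (rule prod.image_gen) simp
  also have "\<dots> = (\<Prod>s\<in>t. y s ^ m)"
    by (intro prod.cong) (auto simp: y E_def power_sum)
  finally have 1: "(\<Prod>i<n. x (piV (\<beta> i)) ^ e i) = (\<Prod>s\<in>t. y s) ^ m" by (simp add: prod_power_distrib)
  have "a ^ m = (\<Prod>i<n. z i ^ e i * x (piV (\<beta> i)) ^ e i)"
    unfolding eq using x(2)[OF pt] by (intro prod.cong) (auto simp: z_def power_mult_distrib[symmetric])
  also have "\<dots> = (\<Prod>i<n. z i ^ e i) * (\<Prod>s\<in>t. y s) ^ m" unfolding prod.distrib 1 ..
  finally have am: "a ^ m = (\<Prod>i<n. z i ^ e i) * (\<Prod>s\<in>t. y s) ^ m" .
  have fint: "finite t" by (simp add: t_def)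
  have Y0: "(\<Prod>s\<in>t. y s) \<noteq> 0" using y0 fint by simp
  have "(a / (\<Prod>s\<in>t. y s)) ^ m = (\<Prod>i<n. z i ^ e i)" using Y0 am by (simp add: power_divide)
  also have "\<dots> \<in> tor" using z tor_power by (intro tor_prod) auto
  finally have "a \<in> piV (\<Prod>s\<in>t. y s)" using tor_root[OF _ m] piV_iff[OF Y0] by blast
  then have "piV a = piV (\<Prod>s\<in>t. y s)" by (rule piV_eq)
  also have "\<dots> = tor * (\<Prod>s\<in>t. vpow (of_nat (E s) / of_nat m) s)"
  proof -
    have "vpow (of_nat (E s) / of_nat m) s \<subseteq> piV (y s) \<and> vpow (of_nat (E s) / of_nat m) s \<noteq> {}"
      if "s \<in> t" for s
      using vpow_piV[OF x(2)[OF that] y0[OF that] m y] x(1)[OF that] by simp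
    from set_prod_subset_piV[OF fint this] show ?thesis by (intro tor_times_eq_piV[symmetric]) auto
  qed
  finally have "piV a = tor * (\<Prod>s\<in>t. vpow (of_nat (E s) / of_nat m) s)" .
  moreover have "t \<subseteq> S" using \<beta> by (auto simp: t_def)
  ultimately show ?thesis using fint unfolding vspan_def
    by (intro CollectI exI[of _ t] exI[of _ "\<lambda>s. of_nat (E s) / of_nat m"]) auto
qed

theorem mainTheorem1:
  fixes \<alpha> :: complex and N J :: nat and b :: "nat \<Rightarrow> complex set"
  assumes "algebraic \<alpha>" and "\<alpha> \<noteq> 0"
    and "bij_betw b {1..N} (Bbar \<alpha>)"
    and "\<forall>i\<in>{1..N}. \<forall>j\<in>{1..N}. i \<le> j \<longrightarrow> Mbar_V (b i) \<le> Mbar_V (b j)"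
    and "J \<in> {1..N}"
    and "piV \<alpha> \<in> vspan (b ` {1..J})"
    and "\<forall>j\<in>{1..N}. j < J \<longrightarrow> piV \<alpha> \<notin> vspan (b ` {1..j})"
  shows "M_inf \<alpha> = Mbar_V (b J)"
proof (rule antisym)
  note Ka = is_subfield_C_K[of \<alpha>] K_algebraic[OF assms(1)]
  have b_img: "b ` {1..N} = Bbar \<alpha>" using assms(3) by (simp add: bij_betw_def)
  have b_ex: "\<exists>g\<in>B \<alpha>. g \<in> alg_units \<and> b j = piV g" if j: "j \<in> {1..N}" for j
  proof -
    have "b j \<in> Bbar \<alpha>" using b_img j by blast
    then obtain g where g: "g \<in> B \<alpha>" "b j = piV g" by (auto simp: Bbar_def)
    then have "g \<in> alg_units" using Ka(2) by (auto simp: B_def alg_units_def)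
    then show ?thesis using g by blast
  qed
  show "M_inf \<alpha> \<le> Mbar_V (b J)"
  \<comment> \<open>Working with every \<open>c\<close> above the infimum avoids deciding whether it
    is attained.\<close>
  proof (rule dense_ge)
    fix c assume c: "Mbar_V (b J) < c"
    have "c \<ge> 1"
    proof -
      obtain g where g: "g \<in> alg_units" "b J = piV g" using b_ex[OF assms(5)] by blast
      obtain y where "y \<in> piV g" "M y < c" using Mbar_V_lessD c g(2) by metis
      then show ?thesis using piV_alg_units[OF g(1)] M_ge_1[of y] by (auto simp: alg_units_def)
    qed
    obtain t r where t: "t \<subseteq> b ` {1..J}" "piV \<alpha> = tor * (\<Prod>s\<in>t. vpow (r s) s)"
      using assms(6) by (auto simp: vspan_def)
    have "vpow (r s) s \<subseteq> small_prods c" if s: "s \<in> t" for s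
    proof -
      obtain j where j: "j \<in> {1..J}" "s = b j" using s t(1) by blast
      then have jN: "j \<in> {1..N}" using assms(5) by auto
      obtain g where g: "g \<in> alg_units" "b j = piV g" using b_ex[OF jN] by blast
      have "Mbar_V (b j) \<le> Mbar_V (b J)" using assms(4,5) jN j(1) by auto
      then show ?thesis using vpow_subset_small_prods[OF g(1), of c] c g(2) j(2) by simp
    qed
    then have sub: "(\<Prod>s\<in>t. vpow (r s) s) \<subseteq> small_prods c" by (rule set_prod_subset_small_prods)
    have "\<alpha> \<in> tor * (\<Prod>s\<in>t. vpow (r s) s)" using t(2) piV_self by blast
    then obtain z u where "\<alpha> = z * u" "z \<in> tor" "u \<in> (\<Prod>s\<in>t. vpow (r s) s)" by (rule set_times_elim)
    then have "\<alpha> \<in> small_prods c"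
      using sub small_prods_tor[OF \<open>c \<ge> 1\<close>] small_prods_mult by blast
    then show "M_inf \<alpha> \<le> c" using M_inf_le \<open>c \<ge> 1\<close> by blast
  qed
  show "Mbar_V (b J) \<le> M_inf \<alpha>"
    unfolding M_inf_def
  proof (rule cInf_greatest)
    show "{Max (M ` set xs) |xs. xs \<noteq> [] \<and> set xs \<subseteq> alg_units \<and> \<alpha> = prod_list xs} \<noteq> {}"
      using assms(1,2) by (auto intro!: exI[of _ "[\<alpha>]"] simp: alg_units_def)
    fix c assume "c \<in> {Max (M ` set xs) |xs. xs \<noteq> [] \<and> set xs \<subseteq> alg_units \<and> \<alpha> = prod_list xs}"
    then obtain xs where xs: "xs \<noteq> []" "set xs \<subseteq> alg_units" "\<alpha> = prod_list xs" "c = Max (M ` set xs)" by blast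
    show "Mbar_V (b J) \<le> c"
    proof (rule ccontr)
      assume "\<not> Mbar_V (b J) \<le> c"
      then have less: "M x < Mbar_V (b J)" if "x \<in> set xs" for x
      proof -
        have "M x \<le> c" unfolding xs(4) using that by (intro Max_ge) auto
        then show ?thesis using \<open>\<not> Mbar_V (b J) \<le> c\<close> by linarith
      qed
      \<comment> \<open>Such a \<open>g\<close> has smaller measure than a representative
        \<open>h\<close> of \<open>b J\<close> in \<open>B \<alpha>\<close>, so it lies in
        \<open>B \<alpha>\<close> itself; the ordering of the \<open>b j\<close> then puts its class
        strictly before \<open>J\<close>.\<close>
      have idx: "\<exists>j\<in>{1..N}. j < J \<and> piV g = b j"
        if g: "g \<in> K \<alpha>" "g \<noteq> 0" "M g < Mbar_V (b J)" for g
      proof -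
        obtain h where h: "h \<in> B \<alpha>" "h \<in> alg_units" "b J = piV h" using b_ex[OF assms(5)] by blast
        have "Mbar_V (b J) \<le> M h" using Mbar_V_le[OF h(2) piV_self] h(3) by simp
        then have "g \<in> B \<alpha>" using g h(1) by (simp add: B_def)
        then have "piV g \<in> b ` {1..N}" unfolding b_img Bbar_def by blast
        then obtain j where j: "j \<in> {1..N}" "piV g = b j" by blast
        have "g \<in> alg_units" using g Ka(2) by (auto simp: alg_units_def)
        then have "Mbar_V (b j) < Mbar_V (b J)" using Mbar_V_le[OF _ piV_self, of g] g(3) j(2) by simp
        then have "j < J" using assms(4,5) j(1) by (meson not_le)
        then show ?thesis using j by blast
      qed
      define \<beta> where "\<beta> i = aut_norm (K \<alpha>) (xs ! i)" for i
      have alg: "algebraic x" "x \<noteq> 0" if "x \<in> set xs" for x using that xs(2) by (auto simp: alg_units_def)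
      have \<beta>: "\<beta> i \<noteq> 0 \<and> (\<exists>j\<in>{1..N}. j < J \<and> piV (\<beta> i) = b j)" if i: "i < length xs" for i
      proof -
        have x: "xs ! i \<in> set xs" using i by simp
        have nz: "\<beta> i \<noteq> 0" unfolding \<beta>_def by (rule aut_norm_nz[OF Ka alg[OF x]])
        moreover have "\<beta> i \<in> K \<alpha>" unfolding \<beta>_def by (rule aut_norm_in[OF Ka alg(1)[OF x]])
        moreover have "M (\<beta> i) < Mbar_V (b J)"
          using M_aut_norm_le[OF Ka K_normal[OF assms(1)] alg(1)[OF x]] less[OF x] unfolding \<beta>_def by simp
        ultimately show ?thesis using idx by blast
      qed
      \<comment> \<open>The list is nonempty and indices start at 1, so \<open>\<beta> 0\<close>
        provides an index below \<open>J\<close>, and \<open>J - 1\<close> is a genuine index to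
        which the minimality of \<open>J\<close> applies.\<close>
      have "J > 1" using \<beta>[of 0] xs(1) by auto
      then have J1: "J - 1 \<in> {1..N}" "J - 1 < J" using assms(5) by auto
      have \<beta>': "\<beta> i \<noteq> 0 \<and> piV (\<beta> i) \<in> b ` {1..J - 1}" if "i < length xs" for i
        using \<beta>[OF that] by force
      obtain m e where "m > 0" "\<alpha> ^ m = (\<Prod>i<length xs. \<beta> i ^ e i)"
        using aut_norm_prod_list[OF Ka, of xs] alg(1) self_in_K[OF assms(1)] unfolding xs(3)[symmetric] \<beta>_def by metis
      then have "piV \<alpha> \<in> vspan (b ` {1..J - 1})"
        using piV_in_vspan[OF assms(2), of m \<beta> e "length xs" "b ` {1..J - 1}"] \<beta>' by blast
      then show False using assms(7) J1 by blast
    qed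
  qed
qed

end
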